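(* Given a string $x$ of length $n$ and an integer $k'$ with $1 \leq k' \leq n$, one can test whether $x$ is $k'$-cyclic coverable in $\mathcal{O}(n)$ time and $\mathcal{O}(n)$ space.
   Context: For a string $u=u_1u_2\cdots u_k$ and $1\le \delta\le k$, the rotation $c_\delta(u)$ is $u_\delta\cdots u_k u_1\cdots u_{\delta-1}$; we write $v=c(u)$ if $v=c_\delta(u)$ for some $\delta$ (i.e. $v$ is a cyclic rotation of $u$). For a string $x=x[1]\cdots x[n]$, $x[\beta..\gamma]$ denotes the substring $x[\beta]x[\beta+1]\cdots x[\gamma]$. A string $x$ of length $n$ is cyclic-coverable by a string $u$ of length $k'$ if for every position $i$, $1\le i\le n$, there exist $\beta\le i\le\gamma$ with $1\le\beta$, $\gamma\le n$, such that $x[\beta..\gamma]=c(u)$. The string $x$ is $k'$-cyclic coverable if it is cyclic-coverable by some string $u$ of length $k'$. *)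

theory Defs
  imports Complex_Main "HOL-Library.Landau_Symbols"
begin

section \<open>Cyclic covers\<close>

definition is_rotation_of :: "'a list \<Rightarrow> 'a list \<Rightarrow> bool" where
  "is_rotation_of v u \<longleftrightarrow> (\<exists>\<delta>\<in>{1..length u}. v = rotate (\<delta> - 1) u)"

text \<open>Positions in strings are counted from 1, whereas \<open>(!)\<close> counts from 0.\<close>

definition substring :: "'a list \<Rightarrow> nat \<Rightarrow> nat \<Rightarrow> 'a list" where
  "substring x \<beta> \<gamma> = map (\<lambda>i. x ! (i - 1)) [\<beta>..<Suc \<gamma>]"

definition cyclic_coverable_by :: "'a list \<Rightarrow> 'a list \<Rightarrow> bool" where
  "cyclic_coverable_by x u \<longleftrightarrow>
     (\<forall>i\<in>{1..length x}. \<exists>\<beta> \<gamma>. 1 \<le> \<beta> \<and> \<beta> \<le> i \<and> i \<le> \<gamma> \<and> \<gamma> \<le> length x \<and>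
        is_rotation_of (substring x \<beta> \<gamma>) u)"

definition cyclic_coverable :: "nat \<Rightarrow> 'a list \<Rightarrow> bool" where
  "cyclic_coverable k x \<longleftrightarrow> (\<exists>u. length u = k \<and> cyclic_coverable_by x u)"


section \<open>Random access machines\<close>

text \<open>
  A unit-cost RAM with the instruction set of Cook and Reckhow (constants, addition, truncated
  subtraction, indirect loads and stores, tests for positivity), but with structured control
  flow instead of jumps. The arguments of the commands are fixed addresses, so a program names
  only constantly many cells directly; all others are reached by \<open>Load\<close> and \<open>Store\<close>.
\<close>

type_synonym memory = "nat \<Rightarrow> nat"

datatype com =
    Skip
  | Imm nat nat          \<comment> \<open>\<open>X\<^sub>i := v\<close>\<close>
  | Add nat nat nat      \<comment> \<open>\<open>X\<^sub>i := X\<^sub>j + X\<^sub>l\<close>\<close>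
  | Sub nat nat nat      \<comment> \<open>\<open>X\<^sub>i := X\<^sub>j - X\<^sub>l\<close>\<close>
  | Load nat nat         \<comment> \<open>\<open>X\<^sub>i := X\<^bsub>X\<^sub>j\<^esub>\<close>\<close>
  | Store nat nat        \<comment> \<open>\<open>X\<^bsub>X\<^sub>i\<^esub> := X\<^sub>j\<close>\<close>
  | Seq com com
  | Cond nat com com     \<comment> \<open>tests \<open>X\<^sub>i > 0\<close>\<close>
  | While nat com        \<comment> \<open>tests \<open>X\<^sub>i > 0\<close>\<close>

text \<open>
  \<open>exec M W p s t s'\<close>: on a machine with the \<open>M\<close> memory cells \<open>0, \<dots>, M - 1\<close>, whose words hold
  the numbers \<open>0, \<dots>, W\<close>, program \<open>p\<close> started in \<open>s\<close> terminates in \<open>s'\<close> after \<open>t\<close> steps.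
  Accessing a cell outside the memory or exceeding the word size gets stuck, that is, no rule
  applies; hence \<open>M\<close> bounds the space used, input included.
\<close>

inductive exec :: "nat \<Rightarrow> nat \<Rightarrow> com \<Rightarrow> memory \<Rightarrow> nat \<Rightarrow> memory \<Rightarrow> bool" for M W :: nat where
  Skip: "exec M W Skip s 1 s"
| Imm: "i < M \<Longrightarrow> v \<le> W \<Longrightarrow> exec M W (Imm i v) s 1 (s(i := v))"
| Add: "i < M \<Longrightarrow> j < M \<Longrightarrow> l < M \<Longrightarrow> s j + s l \<le> W \<Longrightarrow>
    exec M W (Add i j l) s 1 (s(i := s j + s l))"
| Sub: "i < M \<Longrightarrow> j < M \<Longrightarrow> l < M \<Longrightarrow>
    exec M W (Sub i j l) s 1 (s(i := s j - s l))"
| Load: "i < M \<Longrightarrow> j < M \<Longrightarrow> s j < M \<Longrightarrow> exec M W (Load i j) s 1 (s(i := s (s j)))"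
| Store: "i < M \<Longrightarrow> j < M \<Longrightarrow> s i < M \<Longrightarrow> exec M W (Store i j) s 1 (s(s i := s j))"
| Seq: "exec M W p s t s' \<Longrightarrow> exec M W q s' t' s'' \<Longrightarrow> exec M W (Seq p q) s (t + t') s''"
| CondTrue: "i < M \<Longrightarrow> s i > 0 \<Longrightarrow> exec M W p s t s' \<Longrightarrow> exec M W (Cond i p q) s (Suc t) s'"
| CondFalse: "i < M \<Longrightarrow> s i = 0 \<Longrightarrow> exec M W q s t s' \<Longrightarrow> exec M W (Cond i p q) s (Suc t) s'"
| WhileTrue: "i < M \<Longrightarrow> s i > 0 \<Longrightarrow> exec M W p s t s' \<Longrightarrow> exec M W (While i p) s' t' s'' \<Longrightarrow>
    exec M W (While i p) s (Suc (t + t')) s''"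
| WhileFalse: "i < M \<Longrightarrow> s i = 0 \<Longrightarrow> exec M W (While i p) s 1 s"

inductive_cases exec_elims:
  "exec M W Skip s t s'" "exec M W (Imm i v) s t s'" "exec M W (Add i j l) s t s'"
  "exec M W (Sub i j l) s t s'" "exec M W (Load i j) s t s'" "exec M W (Store i j) s t s'"
  "exec M W (Seq p q) s t s'" "exec M W (Cond i p q) s t s'"

inductive_cases exec_WhileE: "exec M W (While i p) s t s'"

lemma exec_deterministic:
  "exec M W p s t s' \<Longrightarrow> exec M W p s u s'' \<Longrightarrow> t = u \<and> s' = s''"
proof (induction arbitrary: u s'' rule: exec.induct)
  case (Seq p s t s' q t' s2)
  from Seq.prems obtain t1 r t2 where "exec M W p s t1 r" "exec M W q r t2 s''" "u = t1 + t2"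
    by (rule exec_elims(7))
  with Seq.IH show ?case by blast
next
  case (CondTrue i s p t s' q)
  from CondTrue.prems obtain t1 where "exec M W p s t1 s''" "u = Suc t1"
    by (rule exec_elims(8)) (use CondTrue.hyps in simp_all)
  with CondTrue.IH show ?case by blast
next
  case (CondFalse i s q t s' p)
  from CondFalse.prems obtain t1 where "exec M W q s t1 s''" "u = Suc t1"
    by (rule exec_elims(8)) (use CondFalse.hyps in simp_all)
  with CondFalse.IH show ?case by blast
next
  case (WhileTrue i s p t s' t' s2)
  from WhileTrue.prems obtain t1 r t2
    where "exec M W p s t1 r" "exec M W (While i p) r t2 s''" "u = Suc (t1 + t2)"
    by (rule exec_WhileE) (use WhileTrue.hyps in simp_all)
  with WhileTrue.IH show ?case by blast
next
  case (WhileFalse i s p)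
  from WhileFalse.prems show ?case
    by (rule exec_WhileE) (use WhileFalse.hyps in simp_all)
qed (erule exec_elims(1-6); simp)+

text \<open>
  Letters are natural numbers, one per cell. The length, the parameter and the string are stored
  consecutively from cell 0 on; all other cells are 0.
\<close>

definition input_memory :: "nat list \<Rightarrow> nat \<Rightarrow> memory" where
  "input_memory x k = (\<lambda>i. let w = length x # k # x in if i < length w then w ! i else 0)"

text \<open>
  The answer is left in cell 0. Words are only assumed to be large enough for the addresses of
  the memory and for the letters; in particular the program cannot exploit long words.
\<close>

definition answers_within ::
    "com \<Rightarrow> nat list \<Rightarrow> nat \<Rightarrow> bool \<Rightarrow> nat \<Rightarrow> nat \<Rightarrow> bool" where
  "answers_within p x k b T M \<longleftrightarrow>
     (\<forall>W. M \<le> W \<and> (\<forall>a\<in>set x. a \<le> W) \<longrightarrow>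
        (\<exists>t s. exec M W p (input_memory x k) t s \<and> t \<le> T \<and> s 0 = (if b then 1 else 0)))"

end

theory Submission
  imports Defs
begin

text \<open>
  A cover of the first letter shows that, up to rotation, \<open>x\<close> can only be covered by its prefix
  \<open>u\<close> of length \<open>k\<close>. A rotation of \<open>u\<close> is a suffix of \<open>u\<close> followed by a prefix of \<open>u\<close>. For a
  cut position \<open>j\<close> let \<open>s j\<close> and \<open>p j\<close> be the lengths of the longest suffix of \<open>u\<close> ending at
  \<open>j\<close> and of the longest prefix of \<open>u\<close> starting at \<open>j\<close>. Occurrences of rotations of \<open>u\<close> that are
  cut at \<open>j\<close> exist iff \<open>k \<le> s j + p j\<close>, and then together they cover exactly the positions from
  \<open>j - s j\<close> to \<open>j + p j - 1\<close>. Hence \<open>x\<close> is covered iff these at most \<open>n + 1\<close> intervals cover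
  all positions, which a sweep over their left ends decides. The numbers \<open>p j\<close> come from the Z-function of \<open>x\<close>,
  the numbers \<open>s j\<close> from that of the reversal of \<open>x u\<close>. All of this only compares letters for
  equality, so it takes linear time for any alphabet.
\<close>

subsection \<open>Programs on registers and arrays\<close>

definition Get :: "nat \<Rightarrow> nat \<Rightarrow> nat \<Rightarrow> com" where
  "Get i a j = Seq (Add 22 (16 + a) j) (Load i 22)"

definition Put :: "nat \<Rightarrow> nat \<Rightarrow> nat \<Rightarrow> com" where
  "Put a j i = Seq (Add 22 (16 + a) j) (Store 22 i)"

fun block :: "com list \<Rightarrow> com" where
  "block [] = Skip"
| "block (c # cs) = Seq c (block cs)"

declare block.simps [simp del]

text \<open>
  Cells 0 to 15 serve as registers, cells 16 to 21 hold the base addresses of six arrays of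
  length \<open>L\<close>, and cell 22 is scratch space for address computations.
\<close>

locale arrays =
  fixes M W L :: nat and base :: "nat \<Rightarrow> nat"
  assumes base_ge: "a < 6 \<Longrightarrow> 23 \<le> base a"
    and base_le: "a < 6 \<Longrightarrow> base a + L \<le> M"
    and base_disjoint: "a < 6 \<Longrightarrow> b < 6 \<Longrightarrow> a \<noteq> b \<Longrightarrow> i < L \<Longrightarrow> j < L \<Longrightarrow> base a + i \<noteq> base b + j"
    and M_le_W: "M \<le> W"
begin

lemma M_ge: "23 \<le> M"
  using base_ge[of 0] base_le[of 0] by simp

definition represents :: "memory \<Rightarrow> (nat \<Rightarrow> nat) \<Rightarrow> (nat \<Rightarrow> nat \<Rightarrow> nat) \<Rightarrow> bool" where
  "represents s r f \<longleftrightarrow> (\<forall>i<16. s i = r i) \<and> (\<forall>a<6. s (16 + a) = base a) \<and>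
     (\<forall>a<6. \<forall>i<L. s (base a + i) = f a i)"

text \<open>A weakest precondition for total correctness, with the running time passed to the
  postcondition. Quantifying over all memories that represent \<open>r\<close> and \<open>f\<close>
  hides cell 22 and every cell outside the registers and arrays.\<close>

definition run ::
    "com \<Rightarrow> (nat \<Rightarrow> nat) \<Rightarrow> (nat \<Rightarrow> nat \<Rightarrow> nat) \<Rightarrow>
     (nat \<Rightarrow> (nat \<Rightarrow> nat) \<Rightarrow> (nat \<Rightarrow> nat \<Rightarrow> nat) \<Rightarrow> bool) \<Rightarrow> bool" where
  "run c r f Q \<longleftrightarrow> (\<forall>s. represents s r f \<longrightarrow>
     (\<exists>t s' r' f'. exec M W c s t s' \<and> represents s' r' f' \<and> Q t r' f'))"

lemma represents_reg:
  assumes "represents s r f" "i < 16"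
  shows "represents (s(i := v)) (r(i := v)) f"
proof -
  have "base a + j \<noteq> i" if "a < 6" for a j
    using base_ge[OF that] assms(2) by simp
  then show ?thesis
    using assms by (auto simp: represents_def)
qed

lemma represents_scratch:
  assumes "represents s r f"
  shows "represents (s(22 := v)) r f"
proof -
  have "base a + j \<noteq> 22" if "a < 6" for a j
    using base_ge[OF that] by simp
  then show ?thesis
    using assms by (auto simp: represents_def)
qed

lemma represents_array:
  assumes "represents s r f" "a < 6" "i < L"
  shows "represents (s(base a + i := v)) r (f(a := (f a)(i := v)))"
proof -
  have "base a + i \<ge> 23" using base_ge[OF assms(2)] by simp
  moreover have "base b + j \<noteq> base a + i" if "b < 6" "b \<noteq> a" "j < L" for b j
    using base_disjoint[of b a j i] assms that by simp
  ultimately show ?thesis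
    using assms unfolding represents_def by auto
qed

lemma run_mono: "run c r f Q \<Longrightarrow> (\<And>t r' f'. Q t r' f' \<Longrightarrow> Q' t r' f') \<Longrightarrow> run c r f Q'"
  unfolding run_def by blast

lemma run_Skip: "Q 1 r f \<Longrightarrow> run Skip r f Q"
  unfolding run_def by (blast intro: exec.Skip)

lemma run_Imm: "i < 16 \<Longrightarrow> v \<le> W \<Longrightarrow> Q 1 (r(i := v)) f \<Longrightarrow> run (Imm i v) r f Q"
  using M_ge unfolding run_def
  by (auto intro!: exI represents_reg intro: exec.Imm)

lemma run_Add:
  assumes "i < 16" "j < 16" "l < 16" "r j + r l \<le> W" "Q 1 (r(i := r j + r l)) f"
  shows "run (Add i j l) r f Q"
  unfolding run_def
proof (intro allI impI)
  fix s assume s: "represents s r f"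
  then have "s j = r j" "s l = r l" using assms by (auto simp: represents_def)
  with assms M_ge have "exec M W (Add i j l) s 1 (s(i := r j + r l))"
    using exec.Add[of i M j l s W] by simp
  with s assms show "\<exists>t s' r' f'. exec M W (Add i j l) s t s' \<and> represents s' r' f' \<and> Q t r' f'"
    using represents_reg by blast
qed

lemma run_Sub:
  assumes "i < 16" "j < 16" "l < 16" "Q 1 (r(i := r j - r l)) f"
  shows "run (Sub i j l) r f Q"
  unfolding run_def
proof (intro allI impI)
  fix s assume s: "represents s r f"
  then have "s j = r j" "s l = r l" using assms by (auto simp: represents_def)
  with assms M_ge have "exec M W (Sub i j l) s 1 (s(i := r j - r l))"
    using exec.Sub[of i M j l W s] by simp
  with s assms show "\<exists>t s' r' f'. exec M W (Sub i j l) s t s' \<and> represents s' r' f' \<and> Q t r' f'"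
    using represents_reg by blast
qed

lemma exec_address:
  assumes "represents s r f" "a < 6" "j < 16" "r j < L"
  shows "exec M W (Add 22 (16 + a) j) s 1 (s(22 := base a + r j))"
proof -
  have "s (16 + a) = base a" "s j = r j" using assms by (auto simp: represents_def)
  moreover have "base a + r j \<le> W" using base_le[OF assms(2)] assms(4) M_le_W by simp
  ultimately show ?thesis
    using exec.Add[of 22 M "16 + a" j s W] assms M_ge by simp
qed

lemma run_Get:
  assumes "a < 6" "i < 16" "j < 16" "r j < L" "Q 2 (r(i := f a (r j))) f"
  shows "run (Get i a j) r f Q"
  unfolding run_def
proof (intro allI impI)
  fix s assume s: "represents s r f"
  let ?s = "s(22 := base a + r j)"
  have rep: "represents ?s r f" using s by (rule represents_scratch)
  have val: "?s (?s 22) = f a (r j)" using rep assms by (auto simp: represents_def)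
  have "?s 22 < M" using base_le[OF assms(1)] assms(4) by simp
  then have "exec M W (Load i 22) ?s 1 (?s(i := f a (r j)))"
    using exec.Load[of i M 22 ?s W] assms M_ge val by simp
  from exec.Seq[OF exec_address[OF s assms(1,3,4)] this]
  have "exec M W (Get i a j) s 2 (?s(i := f a (r j)))" by (simp add: Get_def numeral_2_eq_2)
  moreover have "represents (?s(i := f a (r j))) (r(i := f a (r j))) f"
    using rep assms(2) by (rule represents_reg)
  ultimately show "\<exists>t s' r' f'. exec M W (Get i a j) s t s' \<and> represents s' r' f' \<and> Q t r' f'"
    using assms(5) by blast
qed

lemma run_Put:
  assumes "a < 6" "i < 16" "j < 16" "r j < L" "Q 2 r (f(a := (f a)(r j := r i)))"
  shows "run (Put a j i) r f Q"
  unfolding run_def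
proof (intro allI impI)
  fix s assume s: "represents s r f"
  let ?s = "s(22 := base a + r j)"
  have rep: "represents ?s r f" using s by (rule represents_scratch)
  have val: "?s i = r i" using rep assms by (auto simp: represents_def)
  have "?s 22 < M" using base_le[OF assms(1)] assms(4) by simp
  then have "exec M W (Store 22 i) ?s 1 (?s(base a + r j := r i))"
    using exec.Store[of 22 M i ?s W] assms M_ge val by simp
  from exec.Seq[OF exec_address[OF s assms(1,3,4)] this]
  have "exec M W (Put a j i) s 2 (?s(base a + r j := r i))" by (simp add: Put_def numeral_2_eq_2)
  moreover have "represents (?s(base a + r j := r i)) r (f(a := (f a)(r j := r i)))"
    using rep assms(1,4) by (rule represents_array)
  ultimately show "\<exists>t s' r' f'. exec M W (Put a j i) s t s' \<and> represents s' r' f' \<and> Q t r' f'"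
    using assms(5) by blast
qed

text \<open>The postcondition of the first command is itself a \<open>run\<close> statement about
  the second, so a proof can walk through a program command by command while the times add
  up.\<close>

lemma run_Seq:
  assumes "run p r f (\<lambda>t r' f'. run q r' f' (\<lambda>t'. Q (t + t')))"
  shows "run (Seq p q) r f Q"
  unfolding run_def
proof (intro allI impI)
  fix s assume "represents s r f"
  then obtain t s' r' f' where 1: "exec M W p s t s'" and "represents s' r' f'"
    "run q r' f' (\<lambda>t'. Q (t + t'))"
    using assms unfolding run_def[of p] by blast
  then obtain t' s'' r'' f'' where 2: "exec M W q s' t' s''" and "represents s'' r'' f''"
    "Q (t + t') r'' f''"
    unfolding run_def by blast
  with exec.Seq[OF 1 2]
  show "\<exists>t s' r' f'. exec M W (Seq p q) s t s' \<and> represents s' r' f' \<and> Q t r' f'" by blast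
qed

lemma run_Cond:
  assumes "i < 16" and "r i > 0 \<Longrightarrow> run p r f (\<lambda>t. Q (Suc t))"
    and "r i = 0 \<Longrightarrow> run q r f (\<lambda>t. Q (Suc t))"
  shows "run (Cond i p q) r f Q"
  unfolding run_def
proof (intro allI impI)
  fix s assume s: "represents s r f"
  then have i: "s i = r i" "i < M" using assms(1) M_ge by (auto simp: represents_def)
  show "\<exists>t s' r' f'. exec M W (Cond i p q) s t s' \<and> represents s' r' f' \<and> Q t r' f'"
  proof (cases "r i > 0")
    case True
    then show ?thesis
      using assms(2) s i unfolding run_def by (metis exec.CondTrue)
  next
    case False
    then show ?thesis
      using assms(3) s i unfolding run_def by (metis exec.CondFalse not_gr_zero)
  qed
qed

text \<open>
  The potential \<open>\<phi>\<close> pays for the running time; since every iteration takes time, it also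
  ensures termination.
\<close>

lemma run_While:
  assumes i: "i < 16" and I: "I r f"
    and body: "\<And>r f. I r f \<Longrightarrow> r i > 0 \<Longrightarrow> run p r f (\<lambda>t r' f'. I r' f' \<and> t + \<phi> r' f' < \<phi> r f)"
    and exit: "\<And>t r' f'. I r' f' \<Longrightarrow> r' i = 0 \<Longrightarrow> t + \<phi> r' f' \<le> Suc (\<phi> r f) \<Longrightarrow> Q t r' f'"
  shows "run (While i p) r f Q"
proof -
  have "\<exists>t s' r' f'. exec M W (While i p) s t s' \<and> represents s' r' f' \<and> I r' f' \<and> r' i = 0 \<and>
      t + \<phi> r' f' \<le> Suc (\<phi> r f)" if "represents s r f" "I r f" for s r f
    using that
  proof (induction "\<phi> r f" arbitrary: s r f rule: less_induct)
    case less
    have si: "s i = r i" "i < M" using less.prems i M_ge by (auto simp: represents_def)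
    show ?case
    proof (cases "r i > 0")
      case True
      from body[OF less.prems(2) True] obtain t s1 r1 f1 where 1: "exec M W p s t s1"
        "represents s1 r1 f1" "I r1 f1" "t + \<phi> r1 f1 < \<phi> r f"
        using less.prems(1) unfolding run_def by blast
      with less.hyps[of r1 f1 s1] obtain t' s2 r2 f2 where 2: "exec M W (While i p) s1 t' s2"
        "represents s2 r2 f2" "I r2 f2" "r2 i = 0" "t' + \<phi> r2 f2 \<le> Suc (\<phi> r1 f1)"
        by auto
      have "exec M W (While i p) s (Suc (t + t')) s2"
        using exec.WhileTrue[OF _ _ 1(1) 2(1)] si True by simp
      moreover have "Suc (t + t') + \<phi> r2 f2 \<le> Suc (\<phi> r f)" using 1 2 by simp
      ultimately show ?thesis using 2 by blast
    next
      case False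
      then have "exec M W (While i p) s 1 s" using exec.WhileFalse si by simp
      with False less.prems show ?thesis by fastforce
    qed
  qed
  then show ?thesis using I exit unfolding run_def by blast
qed

lemma run_block_Nil: "Q 1 r f \<Longrightarrow> run (block []) r f Q"
  by (simp add: block.simps run_Skip)

lemma run_block_Cons:
  "run c r f (\<lambda>t r' f'. run (block cs) r' f' (\<lambda>t'. Q (t + t'))) \<Longrightarrow> run (block (c # cs)) r f Q"
  by (simp add: block.simps run_Seq)

lemmas steps = run_Skip run_Imm run_Add run_Sub run_Get run_Put run_Seq run_Cond
  run_block_Nil run_block_Cons

end

subsection \<open>The Z-algorithm\<close>

text \<open>This makes \<open>v\<close> the Z-value at \<open>j\<close> of the string
  \<open>y 0\<close>, ..., \<open>y (m - 1)\<close>; the last conjunct expresses maximality. Strings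
  are functions here because array contents are.\<close>

definition is_lcp :: "(nat \<Rightarrow> 'a) \<Rightarrow> nat \<Rightarrow> nat \<Rightarrow> nat \<Rightarrow> bool" where
  "is_lcp y m j v \<longleftrightarrow> j + v \<le> m \<and> (\<forall>i<v. y i = y (j + i)) \<and> (j + v < m \<longrightarrow> y v \<noteq> y (j + v))"

text \<open>With \<open>a = j\<close> this is a Z-box: the letters from \<open>j\<close> up to but
  excluding \<open>b\<close> form a prefix of \<open>y\<close>.\<close>

definition matches :: "(nat \<Rightarrow> 'a) \<Rightarrow> nat \<Rightarrow> nat \<Rightarrow> nat \<Rightarrow> bool" where
  "matches y j a b \<longleftrightarrow> (\<forall>i. a \<le> i \<and> i < b \<longrightarrow> y i = y (i - j))"

lemma is_lcp_cong:
  assumes "is_lcp y m j v" "\<And>i. i < m \<Longrightarrow> y i = y' i"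
  shows "is_lcp y' m j v"
proof -
  have "y' i = y' (j + i)" if "i < v" for i
    using assms(1) that by (simp add: is_lcp_def flip: assms(2))
  moreover have "y' v \<noteq> y' (j + v)" if "j + v < m"
    using assms(1) that by (simp add: is_lcp_def flip: assms(2))
  ultimately show ?thesis using assms(1) by (simp add: is_lcp_def)
qed

lemma matches_Suc: "matches y j a b \<Longrightarrow> y b = y (b - j) \<Longrightarrow> matches y j a (Suc b)"
  by (auto simp: matches_def less_Suc_eq)

text \<open>Inside the box, the letters from \<open>j\<close> on repeat those from
  \<open>j - l\<close> on. As the match of length \<open>v\<close> ends before the box does, the
  mismatch after it is repeated too.\<close>

lemma is_lcp_shift:
  assumes box: "matches y l l e" and lj: "l < j" and em: "e \<le> m"
    and z: "is_lcp y m (j - l) v" and ve: "v < e - j"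
  shows "is_lcp y m j v"
proof -
  have *: "y (j + i) = y (j - l + i)" if "i < e - j" for i
    using box[unfolded matches_def, rule_format, of "j + i"] that lj by simp
  have "y v \<noteq> y (j - l + v)" using z ve em lj by (auto simp: is_lcp_def)
  then show ?thesis using z ve em * by (auto simp: is_lcp_def)
qed

text \<open>Agreement below \<open>e\<close> comes from the box and the Z-value at
  \<open>j - l\<close>, agreement from \<open>max e j\<close> to \<open>e'\<close> from direct
  comparison. The maximum also covers a position \<open>j\<close> outside the box.\<close>

lemma is_lcp_extend:
  assumes box: "matches y l l e" and lj: "j < e \<longrightarrow> l < j"
    and z: "j < e \<longrightarrow> is_lcp y m (j - l) v \<and> e - j \<le> v"
    and ext: "matches y j (max e j) e'" and e': "max e j \<le> e'" "e' \<le> m"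
    and stop: "e' < m \<Longrightarrow> y e' \<noteq> y (e' - j)"
  shows "is_lcp y m j (e' - j)"
proof -
  have "y i = y (j + i)" if "i < e' - j" for i
  proof (cases "j + i < e")
    case True
    then have "y i = y (j - l + i)" using z by (auto simp: is_lcp_def)
    also have "\<dots> = y (j + i)"
      using box[unfolded matches_def, rule_format, of "j + i"] True lj by auto
    finally show ?thesis .
  next
    case False
    then show ?thesis using ext[unfolded matches_def, rule_format, of "j + i"] that by auto
  qed
  moreover have "j + (e' - j) = e'" using e' by simp
  ultimately show ?thesis using e' stop by (auto simp: is_lcp_def)
qed

text \<open>The comparisons made for \<open>j\<close> yield the box with left end \<open>j\<close>
  that later positions use.\<close>

lemma matches_extend:
  assumes "matches y l l e" "j < e \<longrightarrow> is_lcp y m (j - l) v \<and> e - j \<le> v \<and> l < j"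
    "matches y j (max e j) e'"
  shows "matches y j j e'"
  unfolding matches_def
proof (intro allI impI)
  fix i assume i: "j \<le> i \<and> i < e'"
  show "y i = y (i - j)"
  proof (cases "i < e")
    case True
    then have "y i = y (i - l)" using i assms(1,2) by (auto simp: matches_def)
    also have "i - l = j - l + (i - j)" using True i assms(2) by auto
    also have "y \<dots> = y (i - j)" using True i assms(2) by (auto simp: is_lcp_def)
    finally show ?thesis .
  next
    case False
    then show ?thesis using i assms(3) by (auto simp: matches_def)
  qed
qed

section \<open>The Z-algorithm as a program, with its amortised running time\<close>

definition match_test :: "nat \<Rightarrow> com" where
  "match_test y = block [Sub 8 4 7, Cond 8 (block
     [Get 9 y 7, Sub 10 7 5, Get 10 y 10, Sub 11 9 10, Sub 10 10 9, Add 11 11 10, Sub 8 3 11]) Skip]"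

definition extend :: "nat \<Rightarrow> com" where
  "extend y = block [match_test y, While 8 (block [Add 7 7 3, match_test y])]"

text \<open>
  The length of the string is in cell 4, the current position \<open>j\<close> in cell 5. Cells 6 and 7 hold
  the ends of the matching segment that reaches furthest to the right. Cells 0 and 3 hold the
  constants 0 and 1.
\<close>

definition z_program :: "nat \<Rightarrow> nat \<Rightarrow> com" where
  "z_program y z = block [Imm 5 0, Put z 5 4, Imm 6 0, Imm 7 0, Imm 5 1, Sub 12 4 5,
     While 12 (block
       [Sub 9 7 5, Sub 10 5 6, Get 10 z 10, Sub 11 9 10,
        Cond 11 (Put z 5 10)
          (block [Sub 9 5 7, Add 7 7 9, Add 6 5 0, extend y, Sub 9 7 5, Put z 5 9]),
        Add 5 5 3, Sub 12 4 5]),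
     Put z 4 0]"

context arrays
begin

lemma run_match_test:
  assumes "r 3 = 1" "r 4 < L" "r 7 \<le> r 4" "r 5 \<le> r 7" "y < 6" "\<forall>i<r 4. f y i \<le> W"
    and Q: "\<And>t r'. t \<le> 14 \<Longrightarrow> \<forall>i. i \<notin> {8, 9, 10, 11} \<longrightarrow> r' i = r i \<Longrightarrow>
       r' 8 = (if r 7 < r 4 \<and> f y (r 7) = f y (r 7 - r 5) then 1 else 0) \<Longrightarrow> Q t r' f"
  shows "run (match_test y) r f Q"
proof -
  \<comment> \<open>One of the two differences is 0, so their sum does not exceed the larger letter
    and fits into a word.\<close>
  have W: "f y (r 7) - f y (r 7 - r 5) + (f y (r 7 - r 5) - f y (r 7)) \<le> W" if "r 7 < r 4"
    using assms(6)[rule_format, of "r 7"] assms(6)[rule_format, of "r 7 - r 5"] that by linarith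
  \<comment> \<open>Truncated subtraction in both directions turns a test for equality into a test
    for positivity.\<close>
  have equal: "Suc 0 - (a - b + (b - a)) = (if a = b then 1 else 0)" for a b :: nat
    by auto
  show ?thesis
    unfolding match_test_def
    apply (intro steps)
    using assms(1-6) W apply (simp_all)
     apply (rule Q; simp add: equal)
    apply (rule Q; simp)
    done
qed

lemma run_extend:
  assumes "r 3 = 1" "r 4 < L" "r 7 \<le> r 4" "r 5 \<le> r 7" "y < 6" "\<forall>i<r 4. f y i \<le> W"
    and Q: "\<And>t r'. r 7 \<le> r' 7 \<Longrightarrow> r' 7 \<le> r 4 \<Longrightarrow>
       matches (f y) (r 5) (r 7) (r' 7) \<Longrightarrow>
       (r' 7 < r 4 \<Longrightarrow> f y (r' 7) \<noteq> f y (r' 7 - r 5)) \<Longrightarrow> t \<le> 30 + 20 * (r' 7 - r 7) \<Longrightarrow>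
       \<forall>i. i \<notin> {7, 8, 9, 10, 11} \<longrightarrow> r' i = r i \<Longrightarrow> Q t r' f"
  shows "run (extend y) r f Q"
proof -
  define I where "I r' f' \<longleftrightarrow> f' = f \<and> r 7 \<le> r' 7 \<and> r' 7 \<le> r 4 \<and>
      matches (f y) (r 5) (r 7) (r' 7) \<and>
      r' 8 = (if r' 7 < r 4 \<and> f y (r' 7) = f y (r' 7 - r 5) then 1 else 0) \<and>
      (\<forall>i. i \<notin> {7, 8, 9, 10, 11} \<longrightarrow> r' i = r i)" for r' f'
  have W: "r 4 \<le> W" using assms(2) base_le[of 0] M_le_W by simp
  have body: "run (block [Add 7 7 3, match_test y]) r' f'
        (\<lambda>t r'' f''. I r'' f'' \<and> t + 20 * (r 4 - r'' 7) < 20 * (r 4 - r' 7))"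
    if I: "I r' f'" "0 < r' 8" for r' f'
  proof -
    have lt: "r' 7 < r 4" "f y (r' 7) = f y (r' 7 - r 5)" "f' = f" "r 7 \<le> r' 7"
      and *: "\<forall>i. i \<notin> {7, 8, 9, 10, 11} \<longrightarrow> r' i = r i"
      and prev: "matches (f y) (r 5) (r 7) (r' 7)"
      using I by (auto simp: I_def split: if_splits)
    have prev': "matches (f y) (r 5) (r 7) (Suc (r' 7))"
      using prev lt(2) by (rule matches_Suc)
    have [simp]: "r' 3 = 1" "r' 4 = r 4" "r' 5 = r 5" using * assms(1) by simp_all
    show ?thesis
      apply (intro steps run_match_test)
      using assms lt W apply (simp_all add: I_def prev' *)
      done
  qed
  show ?thesis
    unfolding extend_def
    apply (intro steps run_match_test)
    using assms(1-6) apply simp_all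
    subgoal premises prems for t r1
    proof (rule run_While[where I = I and \<phi> = "\<lambda>r' f'. 20 * (r 4 - r' 7)"])
      show "I r1 f" using prems by (simp add: I_def matches_def)
    next
      fix t' r2 f2
      assume I: "I r2 f2" "r2 8 = 0" and t': "t' + 20 * (r 4 - r2 7) \<le> Suc (20 * (r 4 - r1 7))"
      then have 1: "r 7 \<le> r2 7" "r2 7 \<le> r 4" "f2 = f" "\<forall>i. i \<notin> {7, 8, 9, 10, 11} \<longrightarrow> r2 i = r i"
        and 2: "matches (f y) (r 5) (r 7) (r2 7)"
        and 3: "r2 7 < r 4 \<Longrightarrow> f y (r2 7) \<noteq> f y (r2 7 - r 5)"
        by (auto simp: I_def)
      have "r1 7 = r 7" using prems(2) by simp
      then have 4: "t + (t' + 1) \<le> 30 + 20 * (r2 7 - r 7)"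
        using t' prems(1) 1 assms(3) by linarith
      have "Q (t + (t' + 1)) r2 f"
        using Q[OF 1(1,2) 2 3 4 1(4)] .
      then show "run (block []) r2 f2 (\<lambda>t''. Q (t + (t' + t'')))"
        using \<open>f2 = f\<close> by (intro run_block_Nil) simp
    qed (use body in simp_all)
    done
qed

text \<open>The time is amortised: every position \<open>j\<close> costs a constant, and every
  successful comparison moves the right end of the box, which never moves back.\<close>

lemma run_z_program:
  assumes "r 0 = 0" "r 3 = 1" "0 < r 4" "r 4 < L" "y < 6" "z < 6" "y \<noteq> z" "\<forall>i<r 4. f y i \<le> W"
    and Q: "\<And>t r' f'. t \<le> 200 * r 4 \<Longrightarrow> \<forall>i. i \<notin> {5..12} \<longrightarrow> r' i = r i \<Longrightarrow>
       \<forall>b. b \<noteq> z \<longrightarrow> f' b = f b \<Longrightarrow> \<forall>j\<le>r 4. is_lcp (f y) (r 4) j (f' z j) \<Longrightarrow> Q t r' f'"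
  shows "run (z_program y z) r f Q"
proof -
  \<comment> \<open>A box that reaches beyond \<open>j\<close> starts strictly between 0 and
    \<open>j\<close>, so \<open>j - l\<close> is an earlier position whose Z-value is already
    known.\<close>
  define I where "I r' f' \<longleftrightarrow> (\<forall>i. i \<notin> {5..12} \<longrightarrow> r' i = r i) \<and> (\<forall>b. b \<noteq> z \<longrightarrow> f' b = f b) \<and>
      0 < r' 5 \<and> r' 5 \<le> r 4 \<and> r' 12 = r 4 - r' 5 \<and> r' 7 \<le> r 4 \<and>
      (\<forall>j<r' 5. is_lcp (f y) (r 4) j (f' z j)) \<and>
      (r' 5 < r' 7 \<longrightarrow> 0 < r' 6 \<and> r' 6 < r' 5) \<and>
      matches (f y) (r' 6) (r' 6) (r' 7)" for r' f'
  have W: "r 4 < W" "0 < W" using assms(3,4) base_le[of 0] M_le_W by simp_all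
  have body: "run (block
       [Sub 9 7 5, Sub 10 5 6, Get 10 z 10, Sub 11 9 10,
        Cond 11 (Put z 5 10)
          (block [Sub 9 5 7, Add 7 7 9, Add 6 5 0, extend y, Sub 9 7 5, Put z 5 9]),
        Add 5 5 3, Sub 12 4 5]) r' f'
      (\<lambda>t r'' f''. I r'' f'' \<and>
         t + (100 * (r 4 - r'' 5) + 20 * (r 4 - r'' 7)) < 100 * (r 4 - r' 5) + 20 * (r 4 - r' 7))"
    if I: "I r' f'" "0 < r' 12" for r' f'
  proof -
    have *: "\<forall>i. i \<notin> {5..12} \<longrightarrow> r' i = r i" and j: "0 < r' 5" "r' 5 < r 4" "r' 7 \<le> r 4"
      and lcp: "\<forall>j<r' 5. is_lcp (f y) (r 4) j (f' z j)" and arr: "\<forall>b. b \<noteq> z \<longrightarrow> f' b = f b"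
      and le: "r' 5 < r' 7 \<longrightarrow> 0 < r' 6 \<and> r' 6 < r' 5"
      and box: "matches (f y) (r' 6) (r' 6) (r' 7)"
      using I by (auto simp: I_def)
    have [simp]: "r' 0 = 0" "r' 3 = 1" "r' 4 = r 4" "f' y = f y" using * assms arr by simp_all
    \<comment> \<open>If the box ends at or before \<open>j\<close>, the value read at
      \<open>j - l\<close> is irrelevant: the truncated difference \<open>r' 7 - r' 5\<close> is 0,
      and the branch that compares letters is taken.\<close>
    have earlier: "r' 5 < r' 7 \<longrightarrow> is_lcp (f y) (r 4) (r' 5 - r' 6) (f' z (r' 5 - r' 6)) \<and> r' 6 < r' 5"
      using le j(1) lcp by simp
    have short: "is_lcp (f y) (r 4) (r' 5) (f' z (r' 5 - r' 6))" if "f' z (r' 5 - r' 6) < r' 7 - r' 5"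
      using is_lcp_shift[OF box _ j(3) _ that] earlier that by simp
    have long: "is_lcp (f y) (r 4) (r' 5) (e - r' 5)"
      if "r' 7 - r' 5 \<le> f' z (r' 5 - r' 6)" "max (r' 7) (r' 5) \<le> e" "e \<le> r 4"
        "matches (f y) (r' 5) (max (r' 7) (r' 5)) e"
        "e < r 4 \<Longrightarrow> f y e \<noteq> f y (e - r' 5)" for e
      using is_lcp_extend[OF box, where v = "f' z (r' 5 - r' 6)", OF _ _ that(4,2,3,5)] earlier that(1) by simp
    have long': "matches (f y) (r' 5) (r' 5) e"
      if "r' 7 - r' 5 \<le> f' z (r' 5 - r' 6)" "matches (f y) (r' 5) (max (r' 7) (r' 5)) e" for e
      using matches_extend[OF box _ that(2), where m = "r 4" and v = "f' z (r' 5 - r' 6)"] earlier that(1)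
      by simp
    have max: "r' 7 + (r' 5 - r' 7) = max (r' 7) (r' 5)" by simp
    show ?thesis
      apply (intro run_block_Cons run_Sub run_Get run_Cond)
      using assms(1-8) j W apply simp_all
      apply (intro run_block_Cons run_Sub run_Get run_Cond run_Put)
        apply simp_all
      subgoal
        apply (intro steps)
        apply simp_all
        using j le * arr lcp box short apply (auto simp: I_def less_Suc_eq)
        done
      subgoal
        apply (intro run_Add run_block_Cons)
        apply (simp_all)
        apply (rule run_extend)
        apply (simp_all add: max)
        apply (intro run_block_Cons run_block_Nil run_Sub run_Put run_Add)
        apply (simp_all)
        subgoal premises prems for t r2
        proof -
          note p = prems(1,12-)
          have r2: "r2 i = r i" if "i \<notin> {5..12}" for i
            using p(7) * that by auto
          have "r2 6 = r' 5" using p(7) by simp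
          then have "I (r2(9 := r2 7 - r' 5, 5 := Suc (r' 5), 12 := r 4 - Suc (r' 5)))
              (f'(z := (f' z)(r' 5 := r2 7 - r' 5)))"
            using p(1-5) j r2 arr lcp long[of "r2 7"] long'[of "r2 7"]
            by (auto simp: I_def less_Suc_eq)
          moreover have "16 + (t + (100 * (r 4 - Suc (r' 5)) + 20 * (r 4 - r2 7)))
              < 100 * (r 4 - r' 5) + 20 * (r 4 - r' 7)"
            using p(2,3,6) j by linarith
          ultimately show ?thesis ..
        qed
        done
      done
  qed
  show ?thesis
    unfolding z_program_def
    apply (intro steps)
    using assms(1-8) W apply simp_all
    apply (rule run_While[where I = I and \<phi> = "\<lambda>r' f'. 100 * (r 4 - r' 5) + 20 * (r 4 - r' 7)"])
    apply simp
    apply (simp add: I_def is_lcp_def matches_def)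
    apply (rule body; assumption)
    subgoal premises prems for t r1 f1
    proof -
      have I: "\<forall>i. i \<notin> {5..12} \<longrightarrow> r1 i = r i" "\<forall>b. b \<noteq> z \<longrightarrow> f1 b = f b"
        "r1 5 = r 4" "\<forall>j<r 4. is_lcp (f y) (r 4) j (f1 z j)"
        using prems(10,11) by (auto simp: I_def)
      have t: "Suc (Suc (Suc (Suc (Suc (Suc (Suc (t + 3))))))) \<le> 200 * r 4"
        using prems(12) assms(3) I(3) by simp
      have "is_lcp (f y) (r 4) (r 4) 0" by (simp add: is_lcp_def)
      then have lcp: "\<forall>j\<le>r 4. is_lcp (f y) (r 4) j ((f1(z := (f1 z)(r 4 := 0))) z j)"
        using I(4) by (simp add: le_less)
      have *: "r1 4 = r 4" "r1 0 = 0" using I(1) assms(1) by simp_all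
      have "Q (Suc (Suc (Suc (Suc (Suc (Suc (Suc (t + 3)))))))) r1 (f1(z := (f1 z)(r 4 := 0)))"
        by (rule Q) (use t I(1,2) lcp in simp_all)
      then show ?thesis
        using assms * by (intro run_block_Cons run_block_Nil run_Put) (simp_all add: eval_nat_numeral)
    qed
    done
qed

end

subsection \<open>Rotations of the first \<open>k\<close> letters\<close>

text \<open>Rotation amounts reduce modulo the length. The empty string has no rotations because the
  range of \<delta> is then empty.\<close>

lemma is_rotation_of_iff: "is_rotation_of v u \<longleftrightarrow> u \<noteq> [] \<and> (\<exists>d. v = rotate d u)"
proof
  assume "is_rotation_of v u"
  then show "u \<noteq> [] \<and> (\<exists>d. v = rotate d u)" by (auto simp: is_rotation_of_def)
next
  assume "u \<noteq> [] \<and> (\<exists>d. v = rotate d u)"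
  then obtain d where "u \<noteq> []" "v = rotate d u" by blast
  then have "v = rotate (Suc (d mod length u) - 1) u" "Suc (d mod length u) \<in> {1..length u}"
    by (simp_all add: rotate_conv_mod[of d u] Suc_leI)
  then show "is_rotation_of v u" unfolding is_rotation_of_def by blast
qed

lemma is_rotation_of_common:
  assumes "is_rotation_of v u" "is_rotation_of w u"
  shows "is_rotation_of v w"
proof -
  from assms obtain d e where u: "u \<noteq> []" and v: "v = rotate d u" and w: "w = rotate e u"
    by (auto simp: is_rotation_of_iff)
  \<comment> \<open>Rotating by \<open>e\<close> and then by \<open>?f\<close> amounts to a multiple
    of the length, which changes nothing.\<close>
  let ?f = "length u * e - e"
  have "e \<le> length u * e" using u by (cases u) auto
  then have "rotate ?f w = rotate (length u * e) u"
    by (simp add: w rotate_rotate)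
  also have "\<dots> = u" by (simp add: rotate_conv_mod[of "length u * e"])
  finally have "v = rotate (d + ?f) w" by (simp add: v flip: rotate_rotate)
  then show ?thesis using u w by (auto simp: is_rotation_of_iff)
qed

lemma substring_eq:
  assumes "1 \<le> \<beta>" "\<gamma> \<le> length x"
  shows "substring x \<beta> \<gamma> = take (Suc \<gamma> - \<beta>) (drop (\<beta> - 1) x)"
  using assms by (intro nth_equalityI) (auto simp: substring_def simp del: upt_Suc)

text \<open>An occurrence that covers the first letter starts there, so the prefix of length
  \<open>k\<close> is a rotation of \<open>u\<close> and can replace it. Positions are counted from
  0 from here on.\<close>

lemma cyclic_coverable_iff_windows:
  assumes k: "1 \<le> k" "k \<le> length x"
  shows "cyclic_coverable k x \<longleftrightarrow> (\<forall>p<length x. \<exists>i\<le>p. p < i + k \<and> i + k \<le> length x \<and>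
     is_rotation_of (take k (drop i x)) (take k x))"
proof
  assume "cyclic_coverable k x"
  then obtain u where u: "length u = k" "cyclic_coverable_by x u"
    by (auto simp: cyclic_coverable_def)
  have window: "\<exists>i\<le>p. p < i + k \<and> i + k \<le> length x \<and> is_rotation_of (take k (drop i x)) u"
    if "p < length x" for p
  proof -
    have "Suc p \<in> {1..length x}" using that by simp
    then obtain \<beta> \<gamma> where *: "1 \<le> \<beta>" "\<beta> \<le> Suc p" "Suc p \<le> \<gamma>" "\<gamma> \<le> length x"
      and rot: "is_rotation_of (substring x \<beta> \<gamma>) u"
      using u(2) unfolding cyclic_coverable_by_def by blast
    have "length (substring x \<beta> \<gamma>) = k"
      using rot u(1) by (auto simp: is_rotation_of_iff)
    then have "Suc \<gamma> - \<beta> = k" by (simp add: substring_def del: upt_Suc)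
    with * rot show ?thesis by (intro exI[of _ "\<beta> - 1"]) (auto simp: substring_eq)
  qed
  have "0 < length x" using k by linarith
  from window[OF this] have first: "is_rotation_of (take k x) u" by auto
  show "\<forall>p<length x. \<exists>i\<le>p. p < i + k \<and> i + k \<le> length x \<and>
     is_rotation_of (take k (drop i x)) (take k x)"
    using window is_rotation_of_common[OF _ first] by blast
next
  assume *: "\<forall>p<length x. \<exists>i\<le>p. p < i + k \<and> i + k \<le> length x \<and>
     is_rotation_of (take k (drop i x)) (take k x)"
  have "cyclic_coverable_by x (take k x)"
    unfolding cyclic_coverable_by_def
  proof
    fix p assume "p \<in> {1..length x}"
    then have "p - 1 < length x" "1 \<le> p" by auto
    with * obtain i where i: "i \<le> p - 1" "p - 1 < i + k" "i + k \<le> length x"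
      "is_rotation_of (take k (drop i x)) (take k x)"
      by blast
    have "substring x (Suc i) (i + k) = take k (drop i x)" using i by (simp add: substring_eq)
    then show "\<exists>\<beta> \<gamma>. 1 \<le> \<beta> \<and> \<beta> \<le> p \<and> p \<le> \<gamma> \<and> \<gamma> \<le> length x \<and>
        is_rotation_of (substring x \<beta> \<gamma>) (take k x)"
      using i \<open>1 \<le> p\<close> by (intro exI[of _ "Suc i"] exI[of _ "i + k"]) auto
  qed
  then show "cyclic_coverable k x"
    using k unfolding cyclic_coverable_def by (intro exI[of _ "take k x"]) simp
qed

text \<open>At the cut \<open>j\<close> a suffix of \<open>take k x\<close> ends and a prefix of it
  begins. The suffix condition is read from right to left, as suits the Z-function of a
  reversal.\<close>

lemma rotation_window_iff:
  assumes k: "1 \<le> k" "k \<le> length x" and i: "i + k \<le> length x"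
  shows "is_rotation_of (take k (drop i x)) (take k x) \<longleftrightarrow>
    (\<exists>j. i \<le> j \<and> j \<le> i + k \<and> (\<forall>t<i + k - j. x ! t = x ! (j + t)) \<and>
       (\<forall>t<j - i. x ! (k - 1 - t) = x ! (j - 1 - t)))" (is "_ \<longleftrightarrow> (\<exists>j. ?split j)")
proof -
  let ?u = "take k x" and ?v = "take k (drop i x)"
  have rot: "rotate d ?u = drop d ?u @ take d ?u" if "d \<le> k" for d
    using rotate_append[of "take d ?u" "drop d ?u"] that k
    by (simp only: append_take_drop_id length_take min.absorb2)
  \<comment> \<open>Rotation by \<open>d\<close> leaves \<open>d\<close> letters to the right of the
    cut, so the cut is at \<open>i + k - d\<close>.\<close>
  have split: "?v = drop d ?u @ take d ?u \<longleftrightarrow> ?split (i + k - d)" if d: "d \<le> k" for d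
  proof
    assume eq: "?v = drop d ?u @ take d ?u"
    have nth: "x ! (i + s) = (drop d ?u @ take d ?u) ! s" if "s < k" for s
      using arg_cong[OF eq, of "\<lambda>v. v ! s"] that i by simp
    have "x ! t = x ! (i + k - d + t)" if "t < d" for t
    proof -
      have "k - d + t < k" using that d by linarith
      then have "x ! (i + (k - d + t)) = take d ?u ! t"
        using nth[of "k - d + t"] nth_append_length_plus[of "drop d ?u" "take d ?u" t] k
        by (simp only: length_drop length_take min.absorb2)
      moreover have "i + (k - d + t) = i + k - d + t" using d by simp
      ultimately show ?thesis using that d by simp
    qed
    moreover have "x ! (k - 1 - t) = x ! (i + k - d - 1 - t)" if "t < k - d" for t
    proof -
      have "x ! (i + (k - d - 1 - t)) = x ! (d + (k - d - 1 - t))"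
        using nth[of "k - d - 1 - t"] that d k by (simp add: nth_append)
      moreover have "i + (k - d - 1 - t) = i + k - d - 1 - t" "d + (k - d - 1 - t) = k - 1 - t"
        using that d by auto
      ultimately show ?thesis by simp
    qed
    ultimately show "?split (i + k - d)" using d by auto
  next
    assume "?split (i + k - d)"
    then have 1: "x ! t = x ! (i + k - d + t)" if "t < d" for t using that d by auto
    have 2: "x ! (k - 1 - t) = x ! (i + k - d - 1 - t)" if "t < k - d" for t
      using \<open>?split (i + k - d)\<close> that d by auto
    show "?v = drop d ?u @ take d ?u"
    proof (rule nth_equalityI)
      show "length ?v = length (drop d ?u @ take d ?u)" using d k i by simp
      fix s assume "s < length ?v"
      then have s: "s < k" using i by simp
      show "?v ! s = (drop d ?u @ take d ?u) ! s"
      proof (cases "s < k - d")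
        case True
        \<comment> \<open>Letter \<open>s\<close> of the window, left of the cut, has number
          \<open>k - d - 1 - s\<close> when counting backwards from the cut.\<close>
        have "k - 1 - (k - d - 1 - s) = d + s" "i + k - d - 1 - (k - d - 1 - s) = i + s"
          using True d by auto
        then have "x ! (d + s) = x ! (i + s)" using 2[of "k - d - 1 - s"] True by simp
        then show ?thesis using True s d k i by (simp add: nth_append)
      next
        case False
        then have "i + k - d + (s - (k - d)) = i + s" using d by simp
        then have "x ! (s - (k - d)) = x ! (i + s)" using 1[of "s - (k - d)"] False s d by simp
        then show ?thesis using False s d k i by (simp add: nth_append min.absorb2)
      qed
    qed
  qed
  show ?thesis
  proof
    assume "is_rotation_of ?v ?u"
    then obtain \<delta> where "\<delta> \<in> {1..k}" "?v = rotate (\<delta> - 1) ?u"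
      using k by (auto simp: is_rotation_of_def min.absorb2)
    then have "\<delta> - 1 \<le> k" "?v = drop (\<delta> - 1) ?u @ take (\<delta> - 1) ?u" using rot by auto
    then show "\<exists>j. ?split j" using split by blast
  next
    assume "\<exists>j. ?split j"
    then obtain j where j: "?split j" by blast
    then have "i + k - (i + k - j) = j" "i + k - j \<le> k" by auto
    with j split[of "i + k - j"] have "?v = drop (i + k - j) ?u @ take (i + k - j) ?u" by simp
    then have "?v = rotate (i + k - j) ?u" using rot \<open>i + k - j \<le> k\<close> by simp
    then show "is_rotation_of ?v ?u" using k by (auto simp: is_rotation_of_iff)
  qed
qed

text \<open>Lengths of common prefixes are closed downwards and the Z-value is the largest one; this
  trades \<open>v\<close> for equations between letters.\<close>

lemma le_lcp_iff: "is_lcp y m j v \<Longrightarrow> b \<le> v \<longleftrightarrow> j + b \<le> m \<and> (\<forall>t<b. y t = y (j + t)) \<or> b = 0"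
  unfolding is_lcp_def by (metis add_le_cancel_left le_trans less_le_trans not_le zero_le)

text \<open>\<open>X\<close> is \<open>x\<close> followed by its prefix \<open>u\<close> of length
  \<open>k\<close>, and \<open>Y\<close> is the reversal of that. \<open>Y\<close> begins with the
  reversal of \<open>u\<close>, and from its position \<open>n + k - j\<close> on it reads the
  letters before \<open>j\<close> backwards; so \<open>w\<close> measures suffixes of
  \<open>u\<close> ending at \<open>j\<close>. Z-values are capped at \<open>k\<close>, the length
  of \<open>u\<close>.\<close>

lemma cyclic_coverable_iff_intervals:
  assumes k: "1 \<le> k" "k \<le> length x" and n: "n = length x"
    and X: "\<forall>i<n. X i = x ! i" "\<forall>i<k. X (n + i) = x ! i"
    and Y: "\<forall>i<n + k. Y i = X (n + k - Suc i)"
    and v: "\<forall>j\<le>n. is_lcp X n j (v j)" and w: "\<forall>j\<le>n + k. is_lcp Y (n + k) j (w j)"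
  shows "cyclic_coverable k x \<longleftrightarrow> (\<forall>p<n. \<exists>j\<le>n. k \<le> min k (v j) + min k (w (n + k - j)) \<and>
     j - min k (w (n + k - j)) \<le> p \<and> p < j + min k (v j))"
proof -
  define P where "P j = min k (v j)" for j
  define S where "S j = min k (w (n + k - j))" for j
  have P: "b \<le> P j \<longleftrightarrow> b \<le> k \<and> j + b \<le> n \<and> (\<forall>t<b. x ! t = x ! (j + t))" if "j \<le> n" for b j
  proof -
    have "b \<le> v j \<longleftrightarrow> j + b \<le> n \<and> (\<forall>t<b. X t = X (j + t))"
      using le_lcp_iff[OF v[rule_format, OF that], of b] that by auto
    also have "\<dots> \<longleftrightarrow> j + b \<le> n \<and> (\<forall>t<b. x ! t = x ! (j + t))"
      using X(1) by (intro conj_cong refl) auto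
    finally show ?thesis by (auto simp: P_def)
  qed
  have S: "b \<le> S j \<longleftrightarrow> b \<le> k \<and> b \<le> j \<and> (\<forall>t<b. x ! (k - 1 - t) = x ! (j - 1 - t))"
    if j: "j \<le> n" for b j
  proof -
    have "b \<le> w (n + k - j) \<longleftrightarrow> b \<le> j \<and> (\<forall>t<b. Y t = Y (n + k - j + t))"
      using le_lcp_iff[OF w[rule_format, of "n + k - j"], of b] j by auto
    moreover have "Y t = Y (n + k - j + t) \<longleftrightarrow> x ! (k - 1 - t) = x ! (j - 1 - t)"
      if "t < b" "b \<le> k" "b \<le> j" for t
    proof -
      have "Y t = X (n + (k - 1 - t))" using Y that by simp
      also have "\<dots> = x ! (k - 1 - t)" using that by (intro X(2)[rule_format]) linarith
      finally have "Y t = x ! (k - 1 - t)" .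
      moreover have "Y (n + k - j + t) = X (j - 1 - t)" using Y that j by simp
      ultimately show ?thesis using X(1) that j by simp
    qed
    ultimately show ?thesis by (auto simp: S_def)
  qed
  have window: "is_rotation_of (take k (drop i x)) (take k x) \<longleftrightarrow>
      (\<exists>j. i \<le> j \<and> j \<le> i + k \<and> i + k - j \<le> P j \<and> j - i \<le> S j)" if "i + k \<le> n" for i
    unfolding rotation_window_iff[OF k that[unfolded n]]
    using that by (intro ex_cong1) (auto simp: P S)
  show ?thesis
    unfolding cyclic_coverable_iff_windows[OF k] P_def[symmetric] S_def[symmetric] n[symmetric]
  proof (intro all_cong iffI)
    fix p assume p: "p < n"
    assume "\<exists>i\<le>p. p < i + k \<and> i + k \<le> n \<and> is_rotation_of (take k (drop i x)) (take k x)"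
    then obtain i j where "i \<le> p" "p < i + k" "i + k \<le> n" "i \<le> j" "j \<le> i + k"
      "i + k - j \<le> P j" "j - i \<le> S j"
      using window by blast
    then show "\<exists>j\<le>n. k \<le> P j + S j \<and> j - S j \<le> p \<and> p < j + P j"
      by (intro exI[of _ j]) auto
  next
    fix p assume p: "p < n"
    assume "\<exists>j\<le>n. k \<le> P j + S j \<and> j - S j \<le> p \<and> p < j + P j"
    then obtain j where j: "j \<le> n" "k \<le> P j + S j" "j - S j \<le> p" "p < j + P j" by blast
    have bounds: "j + P j \<le> n" "S j \<le> j" "P j \<le> k" "S j \<le> k"
      using P[OF j(1), of "P j"] S[OF j(1), of "S j"] by auto
    \<comment> \<open>The leftmost window inside the interval of \<open>j\<close> that still reaches
      \<open>p\<close>. It ends within the interval because \<open>k \<le> P j + S j\<close> and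
      \<open>p < j + P j\<close>.\<close>
    define i where "i = max (j - S j) (Suc p - k)"
    have i: "i \<le> p" "p < i + k" "i + k \<le> j + P j" "j - S j \<le> i"
      using j bounds k by (auto simp: i_def)
    then have "is_rotation_of (take k (drop i x)) (take k x)"
      using bounds by (subst window) (auto intro!: exI[of _ j])
    then show "\<exists>i\<le>p. p < i + k \<and> i + k \<le> n \<and> is_rotation_of (take k (drop i x)) (take k x)"
      using i bounds by (intro exI[of _ i]) auto
  qed
qed

subsection \<open>Covering by intervals\<close>

definition for_loop :: "nat \<Rightarrow> com \<Rightarrow> com" where
  "for_loop b c = block [Sub 12 b 5, While 12 (block [c, Add 5 5 3, Sub 12 b 5])]"

text \<open>
  The letters from number 21 on are in array 0 at first. Array 1 receives \<open>x\<close> and then \<open>x u\<close>,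
  array 2 the reversal of \<open>x u\<close>, arrays 3 and 4 the Z-functions, and cell \<open>l\<close> of array 5 the
  largest right end of an interval with left end \<open>l\<close>. Cells 1 and 2 hold \<open>n\<close> and \<open>k\<close>.
\<close>

definition load_rest :: com where
  "load_rest = block [Imm 13 21, Add 5 13 0, for_loop 1 (block [Sub 9 5 13, Get 9 0 9, Put 1 5 9])]"

definition append_prefix :: com where
  "append_prefix = block [Add 4 1 2, Add 5 1 0, for_loop 4 (block [Sub 9 5 1, Get 9 1 9, Put 1 5 9])]"

text \<open>The same loop clears array 5, so nothing has to be known about its previous
  contents.\<close>

definition reverse :: com where
  "reverse = block [Imm 5 0,
     for_loop 4 (block [Sub 9 4 5, Sub 9 9 3, Get 9 1 9, Put 2 5 9, Put 5 5 0])]"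

text \<open>With truncated subtraction, \<open>a - (a - b)\<close> is a minimum,
  \<open>b + (a - b)\<close> a maximum, and \<open>p + s + 1 - k\<close> is positive iff
  \<open>k \<le> p + s\<close>.\<close>

definition add_interval :: com where
  "add_interval = block [Get 6 3 5, Sub 9 6 2, Sub 6 6 9, Sub 7 4 5, Get 7 4 7, Sub 9 7 2, Sub 7 7 9,
     Add 9 6 7, Add 9 9 3, Sub 9 9 2,
     Cond 9 (block [Sub 7 5 7, Add 6 5 6, Get 8 5 7, Sub 9 6 8, Add 8 8 9, Put 5 7 8]) Skip]"

text \<open>The bound is \<open>n + 1\<close> because the cuts at 0 and at \<open>n\<close> both
  count.\<close>

definition intervals :: com where
  "intervals = block [Imm 5 0, Add 14 1 3, for_loop 14 add_interval]"

text \<open>Cell 6 keeps the largest right end met so far. Intervals that start later cannot contain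
  the current position, so it is covered iff cell 6 exceeds it. Cell 7 becomes the answer.\<close>

definition sweep :: com where
  "sweep = block [Imm 5 0, Imm 6 0, Imm 7 1,
     for_loop 1 (block [Get 9 5 5, Sub 9 9 6, Add 6 6 9, Sub 9 6 5, Cond 9 Skip (Imm 7 0)])]"

definition main_program :: com where
  "main_program = block [load_rest, Add 4 1 0, z_program 1 3, append_prefix, reverse, z_program 2 4,
     intervals, sweep, Add 0 7 0]"

context arrays
begin

lemma L_le_W: "L + 23 \<le> W"
  using base_le[of 0] base_ge[of 0] M_le_W by simp

text \<open>The invariant takes the loop variable as an argument, and \<open>frame\<close> makes it
  independent of the cells 5 and 12 that the loop itself changes. The maximum in \<open>Q\<close>
  allows for a start beyond the bound, as in \<open>load_rest\<close> for fewer than 21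
  letters.\<close>

lemma run_for_loop:
  assumes I: "I (r 5) r f" and r: "r 3 = 1" "r b = N" "N < W"
    and b: "b < 16" "b \<noteq> 5" "b \<noteq> 12"
    and frame: "\<And>j r f u v. I j r f \<Longrightarrow> I j (r(5 := u, 12 := v)) f"
    and body: "\<And>j r f. j < N \<Longrightarrow> I j r f \<Longrightarrow> r 5 = j \<Longrightarrow> r 3 = 1 \<Longrightarrow> r b = N \<Longrightarrow>
      run c r f (\<lambda>t r' f'. t \<le> C \<and> r' 5 = j \<and> r' 3 = 1 \<and> r' b = N \<and> I (Suc j) r' f')"
    and Q: "\<And>t r' f'. t \<le> (C + 5) * (N - r 5) + 4 \<Longrightarrow> r' 3 = 1 \<Longrightarrow> r' b = N \<Longrightarrow>
      I (max (r 5) N) r' f' \<Longrightarrow> Q t r' f'"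
  shows "run (for_loop b c) r f Q"
proof -
  define J where "J r' f' \<longleftrightarrow> r' 3 = 1 \<and> r' b = N \<and> r 5 \<le> r' 5 \<and> r' 5 \<le> max (r 5) N \<and>
      r' 12 = N - r' 5 \<and> I (r' 5) r' f'" for r' f'
  define \<phi> where "\<phi> = (\<lambda>(r' :: nat \<Rightarrow> nat) (f' :: nat \<Rightarrow> nat \<Rightarrow> nat). (C + 5) * (N - r' 5))"
  have J: "J (r(12 := N - r 5)) f"
    using frame[OF I, of "r 5" "N - r 5"] r b by (simp add: J_def)
  have step: "run (block [c, Add 5 5 3, Sub 12 b 5]) r1 f1
      (\<lambda>t r' f'. J r' f' \<and> t + \<phi> r' f' < \<phi> r1 f1)" if "J r1 f1" "r1 12 > 0" for r1 f1
  proof (rule run_block_Cons)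
    have lt: "r1 5 < N" using that by (auto simp: J_def)
    have "run c r1 f1 (\<lambda>t r' f'. t \<le> C \<and> r' 5 = r1 5 \<and> r' 3 = 1 \<and> r' b = N \<and> I (Suc (r1 5)) r' f')"
      using that lt by (intro body) (auto simp: J_def)
    then show "run c r1 f1 (\<lambda>t r' f'. run (block [Add 5 5 3, Sub 12 b 5]) r' f'
      (\<lambda>t' r'' f''. J r'' f'' \<and> t + t' + \<phi> r'' f'' < \<phi> r1 f1))"
    proof (rule run_mono)
      fix t r2 f2
      assume *: "t \<le> C \<and> r2 5 = r1 5 \<and> r2 3 = 1 \<and> r2 b = N \<and> I (Suc (r1 5)) r2 f2"
      then have "I (Suc (r1 5)) (r2(5 := Suc (r1 5), 12 := N - Suc (r1 5))) f2"
        using frame by blast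
      then have "J (r2(5 := Suc (r1 5), 12 := N - Suc (r1 5))) f2"
        using * that lt b by (auto simp: J_def)
      moreover have "(C + 5) * (N - r1 5) = (C + 5) * (N - Suc (r1 5)) + (C + 5)"
        using lt by (simp flip: Suc_diff_Suc)
      ultimately show "run (block [Add 5 5 3, Sub 12 b 5]) r2 f2
         (\<lambda>t' r'' f''. J r'' f'' \<and> t + t' + \<phi> r'' f'' < \<phi> r1 f1)"
        using * b lt r(3) by (intro run_block_Cons run_block_Nil run_Add run_Sub) (simp_all add: \<phi>_def)
    qed
  qed
  show ?thesis
    unfolding for_loop_def
  proof (intro run_block_Cons run_Sub)
    show "run (While 12 (block [c, Add 5 5 3, Sub 12 b 5])) (r(12 := r b - r 5)) f
     (\<lambda>t r' f'. run (block []) r' f' (\<lambda>t'. Q (1 + (t + t'))))"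
    proof (rule run_While[where I = J and \<phi> = \<phi>, OF _ _ step])
      fix t r' f'
      assume *: "J r' f'" "r' 12 = 0" "t + \<phi> r' f' \<le> Suc (\<phi> (r(12 := r b - r 5)) f)"
      then have "r' 5 = max (r 5) N" by (auto simp: J_def)
      moreover have "1 + (t + 1) \<le> (C + 5) * (N - r 5) + 4" using * by (simp add: \<phi>_def)
      ultimately show "run (block []) r' f' (\<lambda>t'. Q (1 + (t + t')))"
        using * by (intro run_block_Nil Q) (auto simp: J_def)
    qed (use J r in simp_all)
  qed (use b in simp_all)
qed

section \<open>Correctness and running time of the phases\<close>

definition constants :: "nat \<Rightarrow> nat \<Rightarrow> (nat \<Rightarrow> nat) \<Rightarrow> bool" where
  "constants n k r \<longleftrightarrow> r 0 = 0 \<and> r 1 = n \<and> r 2 = k \<and> r 3 = 1"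

text \<open>The first 21 letters are already in array 1, because their cells 2 to 22 have become
  registers, base addresses and scratch space. The others still lie where the input put them, from
  cell 23 on, which is where array 0 starts.\<close>

lemma run_load_rest:
  assumes "constants n k r" "2 * n < L"
    and "\<forall>i<21. i < n \<longrightarrow> f 1 i = x ! i" "\<forall>i. i + 21 < n \<longrightarrow> f 0 i = x ! (i + 21)"
    and Q: "\<And>t r' f'. t \<le> 20 * n + 10 \<Longrightarrow> constants n k r' \<Longrightarrow> \<forall>i<n. f' 1 i = x ! i \<Longrightarrow> Q t r' f'"
  shows "run load_rest r f Q"
proof -
  define I where "I j r' f' \<longleftrightarrow> constants n k r' \<and> r' 13 = 21 \<and> 21 \<le> j \<and> f' 0 = f 0 \<and>
      (\<forall>i<j. i < n \<longrightarrow> f' 1 i = x ! i)" for j r' and f' :: "nat \<Rightarrow> nat \<Rightarrow> nat"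
  show ?thesis
    unfolding load_rest_def
    apply (intro run_block_Cons run_Imm run_Add)
    using assms(1,2) L_le_W apply (simp_all add: constants_def)
    apply (rule run_for_loop[where I = I and N = n and C = 10])
    using assms(1-3) apply (simp_all add: I_def constants_def)
    subgoal for j r f'
      apply (intro steps)
      apply (simp_all)
      using assms(4)[rule_format, of "j - 21"] apply (auto simp: less_Suc_eq)
      done
    apply (intro run_block_Nil Q)
    apply (auto simp: constants_def)
    done
qed

lemma run_append_prefix:
  assumes "constants n k r" "2 * n < L" "k \<le> n" "\<forall>i<n. f 1 i = x ! i"
    and Q: "\<And>t r' f'. t \<le> 20 * n + 10 \<Longrightarrow> constants n k r' \<Longrightarrow> r' 4 = n + k \<Longrightarrow>
      \<forall>b. b \<noteq> 1 \<longrightarrow> f' b = f b \<Longrightarrow> \<forall>i<n. f' 1 i = x ! i \<Longrightarrow> \<forall>i<k. f' 1 (n + i) = x ! i \<Longrightarrow> Q t r' f'"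
  shows "run append_prefix r f Q"
proof -
  define I where "I j r' f' \<longleftrightarrow> constants n k r' \<and> n \<le> j \<and> (\<forall>b. b \<noteq> 1 \<longrightarrow> f' b = f b) \<and>
      (\<forall>i<n. f' 1 i = x ! i) \<and> (\<forall>i<k. n + i < j \<longrightarrow> f' 1 (n + i) = x ! i)" for j r' f'
  show ?thesis
    unfolding append_prefix_def
    apply (intro run_block_Cons run_Imm run_Add)
    using assms(1-3) L_le_W apply (simp_all add: constants_def)
    apply (rule run_for_loop[where I = I and N = "n + k" and C = 10])
    using assms(1-4) apply (simp_all add: I_def constants_def)
    subgoal for j r f'
      apply (intro steps)
      apply (auto simp: less_Suc_eq)
      apply (metis diff_add_inverse)
      done
    apply (intro run_block_Nil Q)
    apply (auto simp: constants_def)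
    done
qed

lemma run_reverse:
  assumes "constants n k r" "2 * n < L" "k \<le> n" "r 4 = n + k"
    and Q: "\<And>t r' f'. t \<le> 40 * n + 10 \<Longrightarrow> constants n k r' \<Longrightarrow> r' 4 = n + k \<Longrightarrow>
      \<forall>b. b \<noteq> 2 \<and> b \<noteq> 5 \<longrightarrow> f' b = f b \<Longrightarrow> \<forall>i<n + k. f' 2 i = f 1 (n + k - Suc i) \<Longrightarrow>
      \<forall>i<n + k. f' 5 i = 0 \<Longrightarrow> Q t r' f'"
  shows "run reverse r f Q"
proof -
  define I where "I j r' f' \<longleftrightarrow> constants n k r' \<and> (\<forall>b. b \<noteq> 2 \<and> b \<noteq> 5 \<longrightarrow> f' b = f b) \<and>
      (\<forall>i<j. f' 2 i = f 1 (n + k - Suc i)) \<and> (\<forall>i<j. f' 5 i = 0)" for j r' f'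
  show ?thesis
    unfolding reverse_def
    apply (intro run_block_Cons run_Imm run_Add)
    using assms(1-4) L_le_W apply (simp_all add: constants_def)
    apply (rule run_for_loop[where I = I and N = "n + k" and C = 10])
    using assms(1-4) apply (simp_all add: I_def constants_def)
    subgoal for j r f'
      apply ((simp | rule steps)+)
      done
    apply (intro run_block_Nil Q)
    apply (auto simp: constants_def)
    done
qed

lemma run_sweep:
  assumes "constants n k r" "2 * n < L" "\<forall>l\<le>n. f 5 l \<le> n"
    and Q: "\<And>t r' f'. t \<le> 20 * n + 20 \<Longrightarrow> r' 0 = 0 \<Longrightarrow>
      r' 7 = (if \<forall>i<n. \<exists>l\<le>i. i < f 5 l then 1 else 0) \<Longrightarrow> Q t r' f'"
  shows "run sweep r f Q"
proof -
  \<comment> \<open>The maximum in cell 6 is described by the numbers below it; this gives 0 when no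
    entry has been read.\<close>
  define I where "I j r' f' \<longleftrightarrow> constants n k r' \<and> f' = f \<and> r' 6 \<le> n \<and>
      (\<forall>p. p < r' 6 \<longleftrightarrow> (\<exists>l<j. p < f 5 l)) \<and>
      r' 7 = (if \<forall>i<j. \<exists>l\<le>i. i < f 5 l then 1 else 0)" for j r' f'
  have body: "run (block [Get 9 5 5, Sub 9 9 6, Add 6 6 9, Sub 9 6 5, Cond 9 Skip (Imm 7 0)]) r' f'
      (\<lambda>t r'' f''. t \<le> 10 \<and> r'' 5 = j \<and> r'' 3 = 1 \<and> r'' 1 = n \<and> I (Suc j) r'' f'')"
    if "j < n" "I j r' f'" "r' 5 = j" for j r' f'
  proof -
    let ?m = "r' 6 + (f 5 j - r' 6)"
    have c: "constants n k r'" "f' = f" "r' 6 \<le> n"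
      and reach: "\<forall>p. p < r' 6 \<longleftrightarrow> (\<exists>l<j. p < f 5 l)"
      and ok: "r' 7 = (if \<forall>i<j. \<exists>l\<le>i. i < f 5 l then 1 else 0)"
      using that by (auto simp: I_def)
    have m: "?m = max (r' 6) (f 5 j)" by simp
    have "?m \<le> n" using c(3) assms(3) that(1) m by simp
    have reach': "p < ?m \<longleftrightarrow> (\<exists>l<Suc j. p < f 5 l)" for p
      unfolding m less_max_iff_disj reach[rule_format] by (auto simp: less_Suc_eq)
    have ok': "(\<forall>i<Suc j. \<exists>l\<le>i. i < f 5 l) \<longleftrightarrow> (\<forall>i<j. \<exists>l\<le>i. i < f 5 l) \<and> j < ?m"
      unfolding reach' All_less_Suc by (auto simp: less_Suc_eq_le)
    have I_Suc: "I (Suc j) r'' f" if "constants n k r''" "r'' 6 = ?m" "j < ?m \<Longrightarrow> r'' 7 = r' 7"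
      "\<not> j < ?m \<Longrightarrow> r'' 7 = 0" for r''
    proof -
      have "r'' 7 = (if \<forall>i<Suc j. \<exists>l\<le>i. i < f 5 l then 1 else 0)"
        unfolding ok' using that(3,4) ok by (cases "j < ?m") simp_all
      then show ?thesis using that(1,2) reach' \<open>?m \<le> n\<close> by (simp add: I_def)
    qed
    show ?thesis
      using c that(1,3) assms(2) L_le_W \<open>?m \<le> n\<close>
      apply -
      apply ((simp add: constants_def | rule steps)+)
       apply (rule I_Suc; simp add: constants_def)
      apply ((simp add: constants_def | rule steps)+)
      apply (rule I_Suc; simp add: constants_def)
      done
  qed
  show ?thesis
    unfolding sweep_def
    apply (intro run_block_Cons run_Imm run_Add)
    using assms(1,2) L_le_W apply (simp_all add: constants_def)
    apply (rule run_for_loop[where I = I and N = n and C = 10])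
    using body assms(1,2) apply (simp_all add: I_def constants_def)
    apply (intro run_block_Nil Q)
    apply (auto simp: constants_def)
    done
qed

lemma run_add_interval:
  fixes r f
  defines "p \<equiv> min (r 2) (f 3 (r 5))" and "s \<equiv> min (r 2) (f 4 (r 4 - r 5))"
  assumes "r 3 = 1" "r 4 < L" "r 5 < r 4" "2 * r 2 < L" "r 5 + p < L" "f 5 (r 5 - s) \<le> W"
    and Q: "\<And>t r'. t \<le> 30 \<Longrightarrow> \<forall>i. i \<notin> {6, 7, 8, 9} \<longrightarrow> r' i = r i \<Longrightarrow>
      Q t r' (if r 2 \<le> p + s then f(5 := (f 5)(r 5 - s := max (f 5 (r 5 - s)) (r 5 + p))) else f)"
  shows "run add_interval r f Q"
proof -
  have min: "a - (a - b) = min b a" for a b :: nat by auto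
  have max: "b + (a - b) = max b a" for a b :: nat by auto
  have bounds: "p \<le> r 2" "s \<le> r 2" by (simp_all add: p_def s_def)
  have Q1: "Q t r' (f(5 := (f 5)(r 5 - s := max (f 5 (r 5 - s)) (r 5 + p))))"
    if "t \<le> 30" "\<forall>i. i \<notin> {6, 7, 8, 9} \<longrightarrow> r' i = r i" "r 2 \<le> p + s" for t r'
    using Q[OF that(1,2)] that(3) by simp
  have Q2: "Q t r' f"
    if "t \<le> 30" "\<forall>i. i \<notin> {6, 7, 8, 9} \<longrightarrow> r' i = r i" "\<not> r 2 \<le> p + s" for t r'
    using Q[OF that(1,2)] that(3) by simp
  show ?thesis
    unfolding add_interval_def
    using assms(3-8) bounds L_le_W
    apply -
    apply ((simp add: min max flip: p_def s_def | rule steps)+)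
     apply (rule Q1; simp)
    apply ((simp | rule steps)+)
    apply (rule Q2; simp)
    done
qed

lemma run_intervals:
  fixes n k f
  defines "p \<equiv> \<lambda>j. min k (f 3 j)" and "s \<equiv> \<lambda>j. min k (f 4 (n + k - j))"
  assumes "constants n k r" "2 * n < L" "1 \<le> k" "k \<le> n" "r 4 = n + k" "\<forall>i<n + k. f 5 i = 0"
    and le: "\<forall>j\<le>n. j + f 3 j \<le> n"
    and Q: "\<And>t r' f'. t \<le> 100 * n + 50 \<Longrightarrow> constants n k r' \<Longrightarrow>
      \<forall>l\<le>n. \<forall>i. i < f' 5 l \<longleftrightarrow> (\<exists>j\<le>n. k \<le> p j + s j \<and> j - s j = l \<and> i < j + p j) \<Longrightarrow> Q t r' f'"
  shows "run intervals r f Q"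
proof -
  \<comment> \<open>Each entry of array 5 is likewise a maximum given by the numbers below it, with
    0 standing for no interval.\<close>
  define I where "I j r' f' \<longleftrightarrow> constants n k r' \<and> r' 4 = n + k \<and> f' 3 = f 3 \<and> f' 4 = f 4 \<and>
      (\<forall>l\<le>n. \<forall>i. i < f' 5 l \<longleftrightarrow> (\<exists>j'<j. k \<le> p j' + s j' \<and> j' - s j' = l \<and> i < j' + p j'))"
    for j r' and f' :: "nat \<Rightarrow> nat \<Rightarrow> nat"
  have body: "run add_interval r' f' (\<lambda>t r'' f''. t \<le> 30 \<and> r'' 5 = j \<and> r'' 3 = 1 \<and> r'' 14 = Suc n \<and>
      I (Suc j) r'' f'')" if "j < Suc n" "I j r' f'" "r' 5 = j" "r' 14 = Suc n" for j r' f'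
  proof (rule run_add_interval)
    have c: "constants n k r'" "r' 4 = n + k" "f' 3 = f 3" "f' 4 = f 4"
      and R: "\<forall>l\<le>n. \<forall>i. i < f' 5 l \<longleftrightarrow> (\<exists>j'<j. k \<le> p j' + s j' \<and> j' - s j' = l \<and> i < j' + p j')"
      using that by (auto simp: I_def)
    have ps: "min (r' 2) (f' 3 (r' 5)) = p j" "min (r' 2) (f' 4 (r' 4 - r' 5)) = s j"
      using c that by (simp_all add: constants_def p_def s_def)
    have "j + p j \<le> n" using le[rule_format, of j] that by (simp add: p_def)
    then show "r' 5 + min (r' 2) (f' 3 (r' 5)) < L" using ps that assms by simp
    \<comment> \<open>No right end exceeds \<open>n\<close>, which keeps the stored values within a
      word.\<close>
    have "\<not> n < f' 5 (j - s j)"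
    proof
      assume "n < f' 5 (j - s j)"
      moreover have "j - s j \<le> n" using that(1) by simp
      ultimately obtain j' where "j' < j" "n < j' + p j'" using R by blast
      then show False using le[rule_format, of j'] that(1) by (simp add: p_def)
    qed
    then show "f' 5 (r' 5 - min (r' 2) (f' 4 (r' 4 - r' 5))) \<le> W"
      using ps that(3) assms(4) L_le_W by simp
    fix t :: nat and r'' assume r'': "t \<le> 30" "\<forall>i. i \<notin> {6, 7, 8, 9} \<longrightarrow> r'' i = r' i"
    let ?f = "if k \<le> p j + s j then f'(5 := (f' 5)(j - s j := max (f' 5 (j - s j)) (j + p j))) else f'"
    have "i < ?f 5 l \<longleftrightarrow> (\<exists>j'<Suc j. k \<le> p j' + s j' \<and> j' - s j' = l \<and> i < j' + p j')"
      if "l \<le> n" for l i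
      using R[rule_format, OF that, of i] unfolding Ex_less_Suc by (auto simp: less_max_iff_disj)
    then have "I (Suc j) r'' ?f" using c r'' by (auto simp: I_def constants_def)
    then show "t \<le> 30 \<and> r'' 5 = j \<and> r'' 3 = 1 \<and> r'' 14 = Suc n \<and> I (Suc j) r''
       (if r' 2 \<le> min (r' 2) (f' 3 (r' 5)) + min (r' 2) (f' 4 (r' 4 - r' 5))
        then f'(5 := (f' 5)(r' 5 - min (r' 2) (f' 4 (r' 4 - r' 5)) :=
          max (f' 5 (r' 5 - min (r' 2) (f' 4 (r' 4 - r' 5)))) (r' 5 + min (r' 2) (f' 3 (r' 5)))))
        else f')"
      unfolding ps using c r'' that by (auto simp: constants_def split: if_splits)
  qed (use that assms in \<open>auto simp: I_def constants_def\<close>)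
  show ?thesis
    unfolding intervals_def
    apply (intro run_block_Cons run_Imm run_Add)
    using assms(3-7) L_le_W apply (simp_all add: constants_def)
    apply (rule run_for_loop[where I = I and N = "Suc n" and C = 30])
    using body assms(3-8) apply (simp_all add: I_def constants_def)
    apply (intro run_block_Nil Q)
    apply (auto simp: constants_def less_Suc_eq_le)
    done
qed

section \<open>Composition of the phases\<close>

lemma run_main_program:
  assumes c: "constants n k r" and L: "2 * n < L" and k: "1 \<le> k" "k \<le> n" and n: "length x = n"
    and x: "\<forall>i<21. i < n \<longrightarrow> f 1 i = x ! i" "\<forall>i. i + 21 < n \<longrightarrow> f 0 i = x ! (i + 21)"
    and W: "\<forall>a\<in>set x. a \<le> W"
    and Q: "\<And>t r' f'. t \<le> 2000 * n \<Longrightarrow> r' 0 = (if cyclic_coverable k x then 1 else 0) \<Longrightarrow> Q t r' f'"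
  shows "run main_program r f Q"
proof -
  have xW: "x ! i \<le> W" if "i < n" for i using W n that by auto
  have "run main_program r f (\<lambda>t r' f'. t \<le> 2000 * n \<and> r' 0 = (if cyclic_coverable k x then 1 else 0))"
    unfolding main_program_def
  proof (intro run_block_Cons run_load_rest[OF c L x] run_Add)
    fix t1 r1 and f1 :: "nat \<Rightarrow> nat \<Rightarrow> nat"
    assume t1: "t1 \<le> 20 * n + 10" and c1: "constants n k r1" and x1: "\<forall>i<n. f1 1 i = x ! i"
    show "r1 1 + r1 0 \<le> W" using c1 L L_le_W by (simp add: constants_def)
    let ?r1 = "r1(4 := r1 1 + r1 0)" and ?b = "if cyclic_coverable k x then 1 else (0::nat)"
    have c1': "constants n k ?r1" "?r1 4 = n" using c1 by (simp_all add: constants_def)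
    show "run (z_program 1 3) ?r1 f1 (\<lambda>t r' f'.
        run (block [append_prefix, reverse, z_program 2 4, intervals, sweep, Add 0 7 0]) r' f'
          (\<lambda>t' r' f'. t1 + (1 + (t + t')) \<le> 2000 * n \<and> r' 0 = ?b))"
    proof (rule run_z_program)
      show "?r1 0 = 0" "?r1 3 = 1" "0 < ?r1 4" "?r1 4 < L"
        using c1' k L by (simp_all add: constants_def)
      show "\<forall>i<?r1 4. f1 1 i \<le> W" using x1 xW c1' by simp
      fix t2 :: nat and r2 :: "nat \<Rightarrow> nat" and f2 :: "nat \<Rightarrow> nat \<Rightarrow> nat"
      assume "t2 \<le> 200 * ?r1 4" "\<forall>i. i \<notin> {5..12} \<longrightarrow> r2 i = ?r1 i" "\<forall>b. b \<noteq> 3 \<longrightarrow> f2 b = f1 b"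
        "\<forall>j\<le>?r1 4. is_lcp (f1 1) (?r1 4) j (f2 3 j)"
      then have t2: "t2 \<le> 200 * n" and c2: "constants n k r2" and x2: "\<forall>i<n. f2 1 i = x ! i"
        and v: "\<forall>j\<le>n. is_lcp (f1 1) n j (f2 3 j)"
        using c1' x1 by (simp_all add: constants_def)
      have v: "\<forall>j\<le>n. is_lcp (f2 1) n j (f2 3 j)"
        using v \<open>\<forall>b. b \<noteq> 3 \<longrightarrow> f2 b = f1 b\<close> by simp
      show "run (block [append_prefix, reverse, z_program 2 4, intervals, sweep, Add 0 7 0]) r2 f2
          (\<lambda>t' r' f'. t1 + (1 + (t2 + t')) \<le> 2000 * n \<and> r' 0 = ?b)"
      proof (intro run_block_Cons run_append_prefix[of n k r2 f2 x, OF c2 L k(2) x2])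
        fix t3 r3 and f3 :: "nat \<Rightarrow> nat \<Rightarrow> nat"
        assume t3: "t3 \<le> 20 * n + 10" and c3: "constants n k r3" "r3 4 = n + k"
          and f3: "\<forall>b. b \<noteq> 1 \<longrightarrow> f3 b = f2 b"
          and x3: "\<forall>i<n. f3 1 i = x ! i" "\<forall>i<k. f3 1 (n + i) = x ! i"
        show "run reverse r3 f3 (\<lambda>t r' f'.
            run (block [z_program 2 4, intervals, sweep, Add 0 7 0]) r' f'
              (\<lambda>t' r' f'. t1 + (1 + (t2 + (t3 + (t + t')))) \<le> 2000 * n \<and> r' 0 = ?b))"
        proof (intro run_reverse[OF c3(1) L k(2) c3(2)] run_block_Cons)
          fix t4 r4 and f4 :: "nat \<Rightarrow> nat \<Rightarrow> nat"
          assume t4: "t4 \<le> 40 * n + 10" and c4: "constants n k r4" "r4 4 = n + k"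
            and f4: "\<forall>b. b \<noteq> 2 \<and> b \<noteq> 5 \<longrightarrow> f4 b = f3 b"
            and y: "\<forall>i<n + k. f4 2 i = f3 1 (n + k - Suc i)" and zero: "\<forall>i<n + k. f4 5 i = 0"
          show "run (z_program 2 4) r4 f4 (\<lambda>t r' f'.
              run (block [intervals, sweep, Add 0 7 0]) r' f'
                (\<lambda>t' r' f'. t1 + (1 + (t2 + (t3 + (t4 + (t + t'))))) \<le> 2000 * n \<and> r' 0 = ?b))"
          proof (rule run_z_program)
            show "r4 0 = 0" "r4 3 = 1" "0 < r4 4" "r4 4 < L"
              using c4 k L by (simp_all add: constants_def)
            show "\<forall>i<r4 4. f4 2 i \<le> W"
            proof (intro allI impI)
              fix i assume i: "i < r4 4"
              show "f4 2 i \<le> W"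
              proof (cases "n + k - Suc i < n")
                case True
                then show ?thesis using y i c4 x3(1) xW by simp
              next
                case False
                then have "f3 1 (n + k - Suc i) = x ! (k - Suc i)" "k - Suc i < n"
                  using x3(2)[rule_format, of "k - Suc i"] i c4(2) k by auto
                then show ?thesis using y i c4 xW by simp
              qed
            qed
            fix t5 :: nat and r5 :: "nat \<Rightarrow> nat" and f5 :: "nat \<Rightarrow> nat \<Rightarrow> nat"
            assume "t5 \<le> 200 * r4 4" "\<forall>i. i \<notin> {5..12} \<longrightarrow> r5 i = r4 i"
              and f5: "\<forall>b. b \<noteq> 4 \<longrightarrow> f5 b = f4 b"
              and "\<forall>j\<le>r4 4. is_lcp (f4 2) (r4 4) j (f5 4 j)"
            then have t5: "t5 \<le> 400 * n" and c5: "constants n k r5" "r5 4 = n + k"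
              and w: "\<forall>j\<le>n + k. is_lcp (f4 2) (n + k) j (f5 4 j)"
              using c4 k by (simp_all add: constants_def)
            have zero5: "\<forall>i<n + k. f5 5 i = 0" using zero f5 by simp
            have v5: "f5 3 = f2 3" using f5 f4 f3 by simp
            then have le: "\<forall>j\<le>n. j + f5 3 j \<le> n" using v by (simp add: is_lcp_def)
            \<comment> \<open>The first Z-function was computed before \<open>u\<close> was
              appended, and appending leaves the first \<open>n\<close> letters as they
              were.\<close>
            have v3: "\<forall>j\<le>n. is_lcp (f3 1) n j (f5 3 j)"
            proof (intro allI impI)
              fix j assume "j \<le> n"
              then have "is_lcp (f2 1) n j (f5 3 j)" using v v5 by simp
              then show "is_lcp (f3 1) n j (f5 3 j)" by (rule is_lcp_cong) (use x2 x3 in simp)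
            qed
            define p s where "p j = min k (f5 3 j)" and "s j = min k (f5 4 (n + k - j))" for j
            have cover: "cyclic_coverable k x \<longleftrightarrow>
                (\<forall>i<n. \<exists>j\<le>n. k \<le> p j + s j \<and> j - s j \<le> i \<and> i < j + p j)"
              unfolding p_def s_def
              by (rule cyclic_coverable_iff_intervals[OF _ _ _ x3 y v3 w]) (use k n in simp_all)
            show "run (block [intervals, sweep, Add 0 7 0]) r5 f5
                (\<lambda>t' r' f'. t1 + (1 + (t2 + (t3 + (t4 + (t5 + t'))))) \<le> 2000 * n \<and> r' 0 = ?b)"
            proof (intro run_block_Cons run_intervals[of n k r5 f5, OF c5(1) L k c5(2) zero5 le])
              fix t6 r6 and f6 :: "nat \<Rightarrow> nat \<Rightarrow> nat"
              assume t6: "t6 \<le> 100 * n + 50" and c6: "constants n k r6" and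
                "\<forall>l\<le>n. \<forall>i. i < f6 5 l \<longleftrightarrow> (\<exists>j\<le>n. k \<le> min k (f5 3 j) + min k (f5 4 (n + k - j)) \<and>
                  j - min k (f5 4 (n + k - j)) = l \<and> i < j + min k (f5 3 j))"
              then have R: "i < f6 5 l \<longleftrightarrow> (\<exists>j\<le>n. k \<le> p j + s j \<and> j - s j = l \<and> i < j + p j)"
                if "l \<le> n" for l i
                using that by (simp add: p_def s_def)
              have le6: "\<forall>l\<le>n. f6 5 l \<le> n"
              proof (intro allI impI)
                fix l assume "l \<le> n"
                have "\<not> n < f6 5 l"
                proof
                  assume "n < f6 5 l"
                  then obtain j where "j \<le> n" "n < j + p j" using R[OF \<open>l \<le> n\<close>] by blast
                  then show False using le[rule_format, of j] by (simp add: p_def)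
                qed
                then show "f6 5 l \<le> n" by simp
              qed
              \<comment> \<open>Intervals are grouped by their left end, and for each left end only
                the largest right end matters.\<close>
              have cover': "cyclic_coverable k x \<longleftrightarrow> (\<forall>i<n. \<exists>l\<le>i. i < f6 5 l)"
                unfolding cover
              proof (intro all_cong)
                fix i assume i: "i < n"
                show "(\<exists>j\<le>n. k \<le> p j + s j \<and> j - s j \<le> i \<and> i < j + p j) \<longleftrightarrow> (\<exists>l\<le>i. i < f6 5 l)"
                proof
                  assume "\<exists>j\<le>n. k \<le> p j + s j \<and> j - s j \<le> i \<and> i < j + p j"
                  then obtain j where j: "j \<le> n" "k \<le> p j + s j" "j - s j \<le> i" "i < j + p j"
                    by blast
                  then have "i < f6 5 (j - s j)" using R[of "j - s j" i] i by auto
                  then show "\<exists>l\<le>i. i < f6 5 l" using j(3) by blast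
                next
                  assume "\<exists>l\<le>i. i < f6 5 l"
                  then obtain l where "l \<le> i" "i < f6 5 l" by blast
                  then show "\<exists>j\<le>n. k \<le> p j + s j \<and> j - s j \<le> i \<and> i < j + p j"
                    using R[of l i] i by auto
                qed
              qed
              show "run sweep r6 f6 (\<lambda>t r' f'. run (block [Add 0 7 0]) r' f'
                 (\<lambda>t' r' f'. t1 + (1 + (t2 + (t3 + (t4 + (t5 + (t6 + (t + t'))))))) \<le> 2000 * n \<and> r' 0 = ?b))"
              proof (rule run_sweep[of n k r6 f6, OF c6 L le6])
                fix t7 and r7 :: "nat \<Rightarrow> nat" and f7 :: "nat \<Rightarrow> nat \<Rightarrow> nat"
                assume t7: "t7 \<le> 20 * n + 20" and r7: "r7 0 = 0"
                  "r7 7 = (if \<forall>i<n. \<exists>l\<le>i. i < f6 5 l then 1 else 0)"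
                have r7': "r7 7 = ?b" unfolding cover' r7 ..
                have "t1 + (1 + (t2 + (t3 + (t4 + (t5 + (t6 + (t7 + 2))))))) \<le> 2000 * n"
                  using t1 t2 t3 t4 t5 t6 t7 k by linarith
                then show "run (block [Add 0 7 0]) r7 f7
                   (\<lambda>t' r' f'. t1 + (1 + (t2 + (t3 + (t4 + (t5 + (t6 + (t7 + t'))))))) \<le> 2000 * n \<and> r' 0 = ?b)"
                  using r7(1) r7' L_le_W by (intro run_block_Cons run_block_Nil run_Add) auto
              qed
            qed
          qed simp_all
        qed
      qed
    qed simp_all
  qed simp_all
  then show ?thesis by (rule run_mono) (simp add: Q)
qed

end

subsection \<open>Making room for the registers\<close>

text \<open>The counterpart of \<open>run\<close> for the start-up phase, when the memory does not
  yet have the shape required by \<open>represents\<close>.\<close>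

definition exec_to :: "nat \<Rightarrow> nat \<Rightarrow> com \<Rightarrow> memory \<Rightarrow> (nat \<Rightarrow> memory \<Rightarrow> bool) \<Rightarrow> bool" where
  "exec_to M W c s Q \<longleftrightarrow> (\<exists>t s'. exec M W c s t s' \<and> Q t s')"

lemma exec_to_intros:
  "i < M \<Longrightarrow> v \<le> W \<Longrightarrow> Q 1 (s(i := v)) \<Longrightarrow> exec_to M W (Imm i v) s Q"
  "i < M \<Longrightarrow> j < M \<Longrightarrow> l < M \<Longrightarrow> s j + s l \<le> W \<Longrightarrow> Q 1 (s(i := s j + s l)) \<Longrightarrow>
    exec_to M W (Add i j l) s Q"
  "i < M \<Longrightarrow> j < M \<Longrightarrow> l < M \<Longrightarrow> Q 1 (s(i := s j - s l)) \<Longrightarrow> exec_to M W (Sub i j l) s Q"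
  "i < M \<Longrightarrow> j < M \<Longrightarrow> s j < M \<Longrightarrow> Q 1 (s(i := s (s j))) \<Longrightarrow> exec_to M W (Load i j) s Q"
  "i < M \<Longrightarrow> j < M \<Longrightarrow> s i < M \<Longrightarrow> Q 1 (s(s i := s j)) \<Longrightarrow> exec_to M W (Store i j) s Q"
  "Q 1 s \<Longrightarrow> exec_to M W (block []) s Q"
  unfolding exec_to_def block.simps by (blast intro: exec.intros)+

lemma exec_to_Cons:
  "exec_to M W c s (\<lambda>t s'. exec_to M W (block cs) s' (\<lambda>t'. Q (t + t'))) \<Longrightarrow>
    exec_to M W (block (c # cs)) s Q"
  unfolding exec_to_def block.simps by (blast intro: exec.Seq)

lemma exec_toI: "exec M W c s t s' \<Longrightarrow> Q t s' \<Longrightarrow> exec_to M W c s Q"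
  unfolding exec_to_def by blast

lemma exec_to_mono: "exec_to M W c s Q \<Longrightarrow> (\<And>t s'. Q t s' \<Longrightarrow> Q' t s') \<Longrightarrow> exec_to M W c s Q'"
  unfolding exec_to_def by blast

text \<open>Unrolled instead of a loop, since no cell is free for a counter yet.\<close>

fun add_multiple :: "nat \<Rightarrow> com" where
  "add_multiple 0 = Skip"
| "add_multiple (Suc m) = Seq (Add 1 1 0) (add_multiple m)"

lemma exec_add_multiple:
  "1 < M \<Longrightarrow> s 1 + m * s 0 \<le> W \<Longrightarrow> exec M W (add_multiple m) s (Suc m) (s(1 := s 1 + m * s 0))"
proof (induction m arbitrary: s)
  case 0
  then show ?case by (simp add: exec.Skip[simplified])
next
  case (Suc m)
  have 1: "exec M W (Add 1 1 0) s 1 (s(1 := s 1 + s 0))"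
    using Suc.prems by (intro exec.Add) auto
  let ?s = "s(1 := s 1 + s 0)"
  have "exec M W (add_multiple m) ?s (Suc m) (?s(1 := ?s 1 + m * ?s 0))"
    using Suc.prems by (intro Suc.IH) simp_all
  moreover have "?s(1 := ?s 1 + m * ?s 0) = s(1 := s 1 + Suc m * s 0)"
    by (simp add: fun_eq_iff)
  ultimately have "exec M W (add_multiple m) ?s (Suc m) (s(1 := s 1 + Suc m * s 0))"
    by (simp only:)
  from exec.Seq[OF 1 this] show ?case by (simp only: add_multiple.simps plus_1_eq_Suc)
qed

text \<open>Unrolled so that the sources are fixed addresses: the target pointer in cell 0 and the
  constant 1 in cell 1 are then the only work space.\<close>

fun save_cells :: "nat \<Rightarrow> com" where
  "save_cells 0 = Skip"
| "save_cells (Suc i) = Seq (save_cells i) (Seq (Add 0 0 1) (Store 0 (i + 2)))"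

text \<open>The condition \<open>m + 2 \<le> a\<close> keeps all source cells at or below
  \<open>a\<close>, while the copies go above it.\<close>

lemma exec_save_cells:
  assumes "s 0 = a" "s 1 = 1" "m + 2 \<le> a" "a + m < M" "M \<le> W"
  shows "\<exists>s'. exec M W (save_cells m) s (2 * m + 1) s' \<and> s' 0 = a + m \<and>
    (\<forall>j<m. s' (a + 1 + j) = s (j + 2)) \<and> (\<forall>c. 0 < c \<and> c \<le> a \<longrightarrow> s' c = s c)"
  using assms
proof (induction m)
  case 0
  then show ?case by (intro exI[of _ s]) (auto simp: exec.Skip[simplified])
next
  case (Suc m)
  then obtain s' where s': "exec M W (save_cells m) s (2 * m + 1) s'" "s' 0 = a + m"
    "\<forall>j<m. s' (a + 1 + j) = s (j + 2)" "\<forall>c. 0 < c \<and> c \<le> a \<longrightarrow> s' c = s c"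
    by auto
  let ?s = "s'(0 := a + Suc m)"
  have "s' 1 = 1" using s'(4) Suc.prems by simp
  then have "exec M W (Add 0 0 1) s' 1 ?s"
    using exec.Add[of 0 M 0 1 s' W] s'(2) Suc.prems by simp
  moreover have "exec M W (Store 0 (m + 2)) ?s 1 (?s(a + Suc m := s (m + 2)))"
    using exec.Store[of 0 M "m + 2" ?s W] s'(4) Suc.prems by simp
  ultimately have "exec M W (save_cells (Suc m)) s (2 * Suc m + 1) (?s(a + Suc m := s (m + 2)))"
    using exec.Seq[OF s'(1) exec.Seq] by fastforce
  moreover have "\<forall>j<Suc m. (?s(a + Suc m := s (m + 2))) (a + 1 + j) = s (j + 2)"
    using s'(3) by (auto simp: less_Suc_eq)
  moreover have "\<forall>c. 0 < c \<and> c \<le> a \<longrightarrow> (?s(a + Suc m := s (m + 2))) c = s c"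
    using s'(4) by auto
  moreover have "(?s(a + Suc m := s (m + 2))) 0 = a + Suc m" by simp
  ultimately show ?case by blast
qed

text \<open>
  Initially only the cells 0 and 1 have contents that are not letters, and no further cell is
  free at a fixed address. Adding \<open>32 n\<close> to \<open>k\<close> gives an address beyond the input at which \<open>n\<close>
  can be saved, without losing either number.
\<close>

definition free_two_cells :: com where
  "free_two_cells = block [add_multiple 32, Store 1 0, Add 0 0 0, Add 0 0 0, Add 0 0 0, Add 0 0 0,
     Add 0 0 0, Sub 1 1 0, Store 0 1, Add 1 0 1, Load 1 1, Add 0 0 1, Store 0 1, Imm 1 1]"

text \<open>The pointer left by \<open>save_cells\<close> is \<open>33 n + 21\<close>, so
  subtracting 21 gives the address of \<open>n\<close>, and subtracting \<open>n\<close> from that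
  the address of \<open>k\<close>.\<close>

definition set_registers :: com where
  "set_registers = block [Imm 2 21, Sub 3 0 2, Load 4 3, Sub 5 3 4, Load 2 5,
     Add 17 3 1, Add 6 4 4, Add 6 6 1, Add 18 17 6, Add 19 18 6, Add 20 19 6, Add 21 20 6,
     Imm 16 23, Imm 0 0, Add 3 1 0, Add 1 4 0]"

text \<open>Five doublings turn \<open>n\<close> into \<open>32 n\<close>, whose subtraction
  recovers \<open>k\<close>. As \<open>1 \<le> k\<close>, storing \<open>k\<close> at
  \<open>32 n\<close> does not destroy the copy of \<open>n\<close> at \<open>32 n + k\<close>,
  which is then read back.\<close>

lemma exec_free_two_cells:
  assumes "s 0 = n" "s 1 = k" "1 \<le> k" "k \<le> n" "43 * n + 30 \<le> M" "M \<le> W"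
  shows "exec_to M W free_two_cells s (\<lambda>t s'. t \<le> 60 \<and> s' 0 = 33 * n \<and> s' 1 = 1 \<and>
    s' (33 * n) = n \<and> s' (32 * n) = k \<and> (\<forall>c. 2 \<le> c \<and> c < 32 * n \<longrightarrow> s' c = s c))"
proof -
  have "exec M W (add_multiple 32) s (Suc 32) (s(1 := k + 32 * n))"
    using exec_add_multiple[of M s 32 W] assms by simp
  then have add: "Q 33 (s(1 := k + 32 * n)) \<Longrightarrow> exec_to M W (add_multiple 32) s Q" for Q
    by (intro exec_toI) simp_all
  show ?thesis
    unfolding free_two_cells_def
    apply (rule exec_to_Cons, rule add)
    using assms apply -
    apply ((simp | rule exec_to_Cons exec_to_intros)+)
    done
qed

lemma exec_set_registers:
  assumes "s 0 = 33 * n + 21" "s 1 = 1" "s (33 * n) = n" "s (32 * n) = k"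
    "1 \<le> n" "43 * n + 30 \<le> M" "M \<le> W"
  shows "exec_to M W set_registers s (\<lambda>t s'. t \<le> 30 \<and> s' 0 = 0 \<and> s' 1 = n \<and> s' 2 = k \<and> s' 3 = 1 \<and>
    s' 16 = 23 \<and> (\<forall>a<5. s' (17 + a) = 33 * n + 1 + a * (2 * n + 1)) \<and> (\<forall>c\<ge>23. s' c = s c))"
  unfolding set_registers_def
  using assms apply -
  apply ((simp | rule exec_to_Cons exec_to_intros)+)
  done

section \<open>The complete program and its bounds\<close>

definition program :: com where
  "program = block [free_two_cells, save_cells 21, set_registers, main_program]"

text \<open>Array 0 is the input from cell 23 on, left in place, and array 1 starts where
  \<open>save_cells\<close> puts the first letters. Length \<open>2 n + 1\<close> suffices for the
  positions from 0 to \<open>n + k\<close>.\<close>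

definition base_address :: "nat \<Rightarrow> nat \<Rightarrow> nat" where
  "base_address n a = (if a = 0 then 23 else 33 * n + 1 + (a - 1) * (2 * n + 1))"

lemma arrays_base_address:
  assumes "1 \<le> n" "43 * n + 30 \<le> W"
  shows "arrays (43 * n + 30) W (2 * n + 1) (base_address n)"
proof
  fix a :: nat assume "a < 6"
  \<comment> \<open>For concrete array numbers, the products with \<open>2 * n + 1\<close> become
    linear.\<close>
  then have a: "a = 0 \<or> a = 1 \<or> a = 2 \<or> a = 3 \<or> a = 4 \<or> a = 5" by linarith
  then show "23 \<le> base_address n a" "base_address n a + (2 * n + 1) \<le> 43 * n + 30"
    using assms by (auto simp: base_address_def)
  fix b i j :: nat assume "b < 6" and ne: "a \<noteq> b" and ij: "i < 2 * n + 1" "j < 2 * n + 1"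
  then have "b = 0 \<or> b = 1 \<or> b = 2 \<or> b = 3 \<or> b = 4 \<or> b = 5" by linarith
  with a show "base_address n a + i \<noteq> base_address n b + j"
    using ne ij assms(1) by (elim disjE; simp add: base_address_def)
qed (use assms in simp)

text \<open>Array 5 ends below cell \<open>43 n + 6\<close> and the saved cells end at
  \<open>33 n + 21\<close>, so the memory suffices. The start-up takes constant time, which the
  additional \<open>200 n\<close> steps absorb because \<open>n\<close> is positive.\<close>

lemma answers_within_program:
  assumes k: "1 \<le> k" "k \<le> n" and n: "length x = n"
  shows "answers_within program x k (cyclic_coverable k x) (2200 * n) (43 * n + 30)"
  unfolding answers_within_def
proof (intro allI impI)
  let ?M = "43 * n + 30"
  fix W assume W: "?M \<le> W \<and> (\<forall>a\<in>set x. a \<le> W)"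
  then interpret arrays ?M W "2 * n + 1" "base_address n"
    using k by (intro arrays_base_address) auto
  let ?s = "input_memory x k"
  have s: "?s 0 = n" "?s 1 = k" using n by (simp_all add: input_memory_def)
  have letters: "?s (i + 2) = x ! i" if "i < n" for i
    using that n by (simp add: input_memory_def)
  have "exec_to ?M W program ?s (\<lambda>t s'. t \<le> 2200 * n \<and> s' 0 = (if cyclic_coverable k x then 1 else 0))"
    unfolding program_def
  proof (rule exec_to_Cons, rule exec_to_mono[OF exec_free_two_cells])
    fix t1 :: nat and s1
    assume s1: "t1 \<le> 60 \<and> s1 0 = 33 * n \<and> s1 1 = 1 \<and>
      s1 (33 * n) = n \<and> s1 (32 * n) = k \<and> (\<forall>c. 2 \<le> c \<and> c < 32 * n \<longrightarrow> s1 c = ?s c)"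
    obtain s2 where s2: "exec ?M W (save_cells 21) s1 43 s2" "s2 0 = 33 * n + 21"
      "\<forall>j<21. s2 (33 * n + 1 + j) = s1 (j + 2)" "\<forall>c. 0 < c \<and> c \<le> 33 * n \<longrightarrow> s2 c = s1 c"
      using exec_save_cells[of s1 "33 * n" 21 ?M W] s1 k W by auto
    have regs: "exec_to ?M W set_registers s2 (\<lambda>t s'. t \<le> 30 \<and> s' 0 = 0 \<and> s' 1 = n \<and> s' 2 = k \<and> s' 3 = 1 \<and>
        s' 16 = 23 \<and> (\<forall>a<5. s' (17 + a) = 33 * n + 1 + a * (2 * n + 1)) \<and> (\<forall>c\<ge>23. s' c = s2 c))"
      by (rule exec_set_registers) (use s1 s2 k W in simp_all)
    have "exec_to ?M W (block [set_registers, main_program]) s2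
        (\<lambda>t s'. t1 + (43 + t) \<le> 2200 * n \<and> s' 0 = (if cyclic_coverable k x then 1 else 0))"
    proof (rule exec_to_Cons, rule exec_to_mono[OF regs])
      fix t3 :: nat and s3
      assume s3: "t3 \<le> 30 \<and> s3 0 = 0 \<and> s3 1 = n \<and> s3 2 = k \<and> s3 3 = 1 \<and> s3 16 = 23 \<and>
        (\<forall>a<5. s3 (17 + a) = 33 * n + 1 + a * (2 * n + 1)) \<and> (\<forall>c\<ge>23. s3 c = s2 c)"
      let ?f = "\<lambda>a i. s3 (base_address n a + i)"
      have bases: "s3 (16 + a) = base_address n a" if "a < 6" for a
      proof (cases a)
        case 0
        then show ?thesis using s3 by (simp add: base_address_def)
      next
        case (Suc a')
        then have "s3 (17 + a') = 33 * n + 1 + a' * (2 * n + 1)" using s3 that by simp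
        then show ?thesis using Suc by (simp add: base_address_def)
      qed
      \<comment> \<open>Once the base addresses are set, the memory represents itself, with
        \<open>?f\<close> reading off the arrays.\<close>
      have rep: "represents s3 s3 ?f" using bases unfolding represents_def by simp
      have "run main_program s3 ?f
          (\<lambda>t r f. t \<le> 2000 * n \<and> r 0 = (if cyclic_coverable k x then 1 else 0))"
      proof (rule run_main_program[of n k s3 x ?f, OF _ _ k n])
        show "constants n k s3" using s3 by (simp add: constants_def)
        show "\<forall>i<21. i < n \<longrightarrow> ?f 1 i = x ! i"
        proof (intro allI impI)
          fix i assume i: "i < 21" "i < n"
          have "?f 1 i = s1 (i + 2)" using s3 s2(3) i by (simp add: base_address_def)
          also have "\<dots> = ?s (i + 2)" using s1 i by simp
          finally show "?f 1 i = x ! i" using letters i by simp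
        qed
        show "\<forall>i. i + 21 < n \<longrightarrow> ?f 0 i = x ! (i + 21)"
        proof (intro allI impI)
          fix i assume i: "i + 21 < n"
          have "?f 0 i = s2 (23 + i)" using s3 by (simp add: base_address_def)
          also have "\<dots> = s1 (23 + i)" using s2(4) i by simp
          also have "\<dots> = ?s (i + 21 + 2)" using s1 i by (simp add: add.commute)
          finally show "?f 0 i = x ! (i + 21)" using letters[of "i + 21"] i by simp
        qed
      qed (use W in auto)
      then obtain t s' r f where *: "exec ?M W main_program s3 t s'" "represents s' r f"
        "t \<le> 2000 * n" "r 0 = (if cyclic_coverable k x then 1 else 0)"
        using rep unfolding run_def by blast
      have "exec_to ?M W main_program s3
          (\<lambda>t s'. t \<le> 2000 * n \<and> s' 0 = (if cyclic_coverable k x then 1 else 0))"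
      proof -
        have "s' 0 = r 0" using *(2) unfolding represents_def by simp
        then show ?thesis
          using *(3,4) by (intro exec_toI[OF *(1)]) simp
      qed
      then show "exec_to ?M W (block [main_program]) s3 (\<lambda>t s'. t1 + (43 + (t3 + t)) \<le> 2200 * n \<and>
          s' 0 = (if cyclic_coverable k x then 1 else 0))"
        using s1 s3 k by (intro exec_to_Cons) (auto elim!: exec_to_mono intro!: exec_to_intros)
    qed
    then show "exec_to ?M W (block [save_cells 21, set_registers, main_program]) s1
        (\<lambda>t s'. t1 + t \<le> 2200 * n \<and> s' 0 = (if cyclic_coverable k x then 1 else 0))"
      by (rule exec_to_Cons[OF exec_toI[OF s2(1)]])
  qed (use s k W in auto)
  then show "\<exists>t s. exec ?M W program ?s t s \<and> t \<le> 2200 * n \<and> s 0 = (if cyclic_coverable k x then 1 else 0)"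
    unfolding exec_to_def by blast
qed

theorem theorem4:
  "\<exists>(p :: com) (T :: nat \<Rightarrow> nat) (S :: nat \<Rightarrow> nat).
     (\<lambda>n. real (T n)) \<in> O(\<lambda>n. real n) \<and>
     (\<lambda>n. real (S n)) \<in> O(\<lambda>n. real n) \<and>
     (\<forall>(x :: nat list) n k'. length x = n \<and> 1 \<le> k' \<and> k' \<le> n \<longrightarrow>
        answers_within p x k' (cyclic_coverable k' x) (T n) (S n))"
proof (intro exI conjI allI impI)
  show "(\<lambda>n. real (2200 * n)) \<in> O(\<lambda>n. real n)" by simp
  show "(\<lambda>n. real (43 * n + 30)) \<in> O(\<lambda>n. real n)"
  proof (rule bigoI)
    \<comment> \<open>For \<open>n\<close> at least 1, the constant 30 is at most
      \<open>30 n\<close>, and 73 is 43 + 30.\<close>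
    show "\<forall>\<^sub>F n in sequentially. norm (real (43 * n + 30)) \<le> 73 * norm (real n)"
      using eventually_ge_at_top[of 1] by eventually_elim simp
  qed
  fix x :: "nat list" and n k' :: nat
  assume "length x = n \<and> 1 \<le> k' \<and> k' \<le> n"
  then show "answers_within program x k' (cyclic_coverable k' x) (2200 * n) (43 * n + 30)"
    by (intro answers_within_program) auto
qed

end
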